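(* Let $\mathcal{I}$ be a small category and let $\mathcal{C}$ be a complete monoidal category. If $\mathcal{C}$ is pre-rigid, so is the functor category $[\mathcal{I},\mathcal{C}]$.
   Context: A monoidal category $(\mathcal{C},\otimes,\mathbb{I})$ is (right) pre-rigid if for every object $X$ there are an object $X^*$ (a pre-dual of $X$) and a morphism $\mathrm{ev}_X:X^*\otimes X\to\mathbb{I}$ such that for every object $T$ the map $\mathrm{Hom}_{\mathcal{C}}(T,X^* )\to\mathrm{Hom}_{\mathcal{C}}(T\otimes X,\mathbb{I})$, $u\mapsto \mathrm{ev}_X\circ(u\otimes X)$, is bijective. Here $X$ also denotes the identity morphism of $X$. No braiding is assumed. The functor category $[\mathcal{I},\mathcal{C}]$ carries the pointwise monoidal structure: $(T\otimes F)(x)=T(x)\otimes F(x)$, with unit object the constant functor on $\mathbb{I}$. *)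

theory Defs
  imports "HOL-Library.FuncSet"
begin

unbundle cardinal_syntax

section \<open>Categories\<close>

text \<open>
  Objects and arrows are explicit carrier sets; nothing is required of the operations outside
  these carriers. \<open>g \<cdot>\<^bsub>C\<^esub> f\<close> is the composite ``first f, then g''.
\<close>

record ('o, 'a) category =
  Obj :: "'o set"
  Arr :: "'a set"
  Dom :: "'a \<Rightarrow> 'o"
  Cod :: "'a \<Rightarrow> 'o"
  Id :: "'o \<Rightarrow> 'a"
  Comp :: "'a \<Rightarrow> 'a \<Rightarrow> 'a"  (infixr "\<cdot>\<index>" 70)

definition Hom :: "('o, 'a, 'x) category_scheme \<Rightarrow> 'o \<Rightarrow> 'o \<Rightarrow> 'a set" where
  "Hom C X Y = {f \<in> Arr C. Dom C f = X \<and> Cod C f = Y}"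

locale category =
  fixes C :: "('o, 'a, 'x) category_scheme"  (structure)
  assumes Dom_closed: "f \<in> Arr C \<Longrightarrow> Dom C f \<in> Obj C"
    and Cod_closed: "f \<in> Arr C \<Longrightarrow> Cod C f \<in> Obj C"
    and Id_Hom: "X \<in> Obj C \<Longrightarrow> Id C X \<in> Hom C X X"
    and Comp_Hom: "\<lbrakk>f \<in> Hom C X Y; g \<in> Hom C Y Z\<rbrakk> \<Longrightarrow> g \<cdot> f \<in> Hom C X Z"
    and Comp_Id: "f \<in> Hom C X Y \<Longrightarrow> f \<cdot> Id C X = f"
    and Id_Comp: "f \<in> Hom C X Y \<Longrightarrow> Id C Y \<cdot> f = f"
    and Comp_assoc: "\<lbrakk>f \<in> Hom C W X; g \<in> Hom C X Y; h \<in> Hom C Y Z\<rbrakk>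
          \<Longrightarrow> (h \<cdot> g) \<cdot> f = h \<cdot> (g \<cdot> f)"

definition is_iso :: "('o, 'a, 'x) category_scheme \<Rightarrow> 'a \<Rightarrow> bool" where
  "is_iso C f \<longleftrightarrow> f \<in> Arr C \<and>
     (\<exists>g \<in> Hom C (Cod C f) (Dom C f).
        g \<cdot>\<^bsub>C\<^esub> f = Id C (Dom C f) \<and> f \<cdot>\<^bsub>C\<^esub> g = Id C (Cod C f))"

section \<open>Functors and natural transformations\<close>

text \<open>
  The maps below are \<^const>\<open>extensional\<close> on the relevant carriers, so that HOL equality of
  functors and of natural transformations is the mathematical equality.
\<close>

datatype ('i, 'j, 'o, 'a) cat_functor =
  Functor (omap: "'i \<Rightarrow> 'o") (amap: "'j \<Rightarrow> 'a")

datatype ('i, 'j, 'o, 'a) nat_trans =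
  NatTrans (source: "('i, 'j, 'o, 'a) cat_functor") (target: "('i, 'j, 'o, 'a) cat_functor")
    (component: "'i \<Rightarrow> 'a")

definition is_functor ::
  "('i, 'j, 'x) category_scheme \<Rightarrow> ('o, 'a, 'y) category_scheme \<Rightarrow>
   ('i, 'j, 'o, 'a) cat_functor \<Rightarrow> bool" where
  "is_functor J C F \<longleftrightarrow>
     omap F \<in> extensional (Obj J) \<and>
     amap F \<in> extensional (Arr J) \<and>
     (\<forall>x \<in> Obj J. omap F x \<in> Obj C) \<and>
     (\<forall>x \<in> Obj J. \<forall>y \<in> Obj J. \<forall>f \<in> Hom J x y. amap F f \<in> Hom C (omap F x) (omap F y)) \<and>
     (\<forall>x \<in> Obj J. amap F (Id J x) = Id C (omap F x)) \<and>
     (\<forall>f \<in> Arr J. \<forall>g \<in> Arr J. Cod J f = Dom J g \<longrightarrow>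
        amap F (g \<cdot>\<^bsub>J\<^esub> f) = amap F g \<cdot>\<^bsub>C\<^esub> amap F f)"

definition is_nat_trans ::
  "('i, 'j, 'x) category_scheme \<Rightarrow> ('o, 'a, 'y) category_scheme \<Rightarrow>
   ('i, 'j, 'o, 'a) nat_trans \<Rightarrow> bool" where
  "is_nat_trans J C t \<longleftrightarrow>
     is_functor J C (source t) \<and>
     is_functor J C (target t) \<and>
     component t \<in> extensional (Obj J) \<and>
     (\<forall>x \<in> Obj J. component t x \<in> Hom C (omap (source t) x) (omap (target t) x)) \<and>
     (\<forall>f \<in> Arr J. component t (Cod J f) \<cdot>\<^bsub>C\<^esub> amap (source t) f
                  = amap (target t) f \<cdot>\<^bsub>C\<^esub> component t (Dom J f))"

section \<open>Smallness and completeness\<close>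

text \<open>
  Smallness is relative to an infinite cardinal \<open>\<kappa>\<close> in the sense of
  \<^theory>\<open>HOL.BNF_Cardinal_Order_Relation\<close>: a set is small if it has fewer than \<open>\<kappa>\<close> elements.
  For \<open>\<kappa>\<close> inaccessible these are the sets isomorphic to an element of the corresponding
  Grothendieck universe.
\<close>

locale small_category = category +
  fixes \<kappa> :: "'u rel"
  assumes small_Obj: "|Obj C| <o \<kappa>"
    and small_Arr: "|Arr C| <o \<kappa>"

definition is_cone ::
  "('i, 'j, 'x) category_scheme \<Rightarrow> ('o, 'a, 'y) category_scheme \<Rightarrow>
   ('i, 'j, 'o, 'a) cat_functor \<Rightarrow> 'o \<Rightarrow> ('i \<Rightarrow> 'a) \<Rightarrow> bool" where
  "is_cone J C D L p \<longleftrightarrow>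
     L \<in> Obj C \<and>
     (\<forall>x \<in> Obj J. p x \<in> Hom C L (omap D x)) \<and>
     (\<forall>f \<in> Arr J. amap D f \<cdot>\<^bsub>C\<^esub> p (Dom J f) = p (Cod J f))"

definition is_limit ::
  "('i, 'j, 'x) category_scheme \<Rightarrow> ('o, 'a, 'y) category_scheme \<Rightarrow>
   ('i, 'j, 'o, 'a) cat_functor \<Rightarrow> 'o \<Rightarrow> ('i \<Rightarrow> 'a) \<Rightarrow> bool" where
  "is_limit J C D L p \<longleftrightarrow>
     is_cone J C D L p \<and>
     (\<forall>M q. is_cone J C D M q \<longrightarrow>
        (\<exists>!h. h \<in> Hom C M L \<and> (\<forall>x \<in> Obj J. p x \<cdot>\<^bsub>C\<^esub> h = q x)))"

text \<open>
  HOL cannot quantify over the type of the index category. Taking its objects and arrows in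
  the type underlying \<open>\<kappa>\<close> loses nothing: a set with fewer than \<open>\<kappa>\<close> elements embeds into
  \<open>Field \<kappa>\<close>, so every \<open>\<kappa>\<close>-small category is isomorphic to one of this form.
\<close>

definition complete :: "'u rel \<Rightarrow> ('o, 'a, 'x) category_scheme \<Rightarrow> bool" where
  "complete \<kappa> C \<longleftrightarrow>
     (\<forall>(J :: ('u, 'u) category) D. small_category J \<kappa> \<longrightarrow> is_functor J C D \<longrightarrow>
        (\<exists>L p. is_limit J C D L p))"

section \<open>Monoidal categories and pre-rigidity\<close>

record ('o, 'a) monoidal_category = "('o, 'a) category" +
  TensO :: "'o \<Rightarrow> 'o \<Rightarrow> 'o"  (infixr "\<otimes>\<index>" 75)
  TensA :: "'a \<Rightarrow> 'a \<Rightarrow> 'a"  (infixr "\<otimes>\<^sub>a\<index>" 75)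
  Unit :: "'o"  ("\<one>\<index>")
  assoc :: "'o \<Rightarrow> 'o \<Rightarrow> 'o \<Rightarrow> 'a"
  lunit :: "'o \<Rightarrow> 'a"
  runit :: "'o \<Rightarrow> 'a"

locale monoidal_category = category C
  for C :: "('o, 'a, 'x) monoidal_category_scheme"  (structure) +
  assumes TensO_closed: "\<lbrakk>X \<in> Obj C; Y \<in> Obj C\<rbrakk> \<Longrightarrow> X \<otimes> Y \<in> Obj C"
    and TensA_Hom: "\<lbrakk>f \<in> Hom C X X'; g \<in> Hom C Y Y'\<rbrakk>
          \<Longrightarrow> f \<otimes>\<^sub>a g \<in> Hom C (X \<otimes> Y) (X' \<otimes> Y')"
    and TensA_Id: "\<lbrakk>X \<in> Obj C; Y \<in> Obj C\<rbrakk> \<Longrightarrow> Id C X \<otimes>\<^sub>a Id C Y = Id C (X \<otimes> Y)"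
    and TensA_Comp: "\<lbrakk>f \<in> Hom C X X'; f' \<in> Hom C X' X''; g \<in> Hom C Y Y'; g' \<in> Hom C Y' Y''\<rbrakk>
          \<Longrightarrow> (f' \<cdot> f) \<otimes>\<^sub>a (g' \<cdot> g) = (f' \<otimes>\<^sub>a g') \<cdot> (f \<otimes>\<^sub>a g)"
    and Unit_closed: "\<one> \<in> Obj C"
    and assoc_Hom: "\<lbrakk>X \<in> Obj C; Y \<in> Obj C; Z \<in> Obj C\<rbrakk>
          \<Longrightarrow> assoc C X Y Z \<in> Hom C ((X \<otimes> Y) \<otimes> Z) (X \<otimes> (Y \<otimes> Z))"
    and assoc_iso: "\<lbrakk>X \<in> Obj C; Y \<in> Obj C; Z \<in> Obj C\<rbrakk> \<Longrightarrow> is_iso C (assoc C X Y Z)"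
    and assoc_natural: "\<lbrakk>f \<in> Hom C X X'; g \<in> Hom C Y Y'; h \<in> Hom C Z Z'\<rbrakk>
          \<Longrightarrow> assoc C X' Y' Z' \<cdot> ((f \<otimes>\<^sub>a g) \<otimes>\<^sub>a h)
              = (f \<otimes>\<^sub>a (g \<otimes>\<^sub>a h)) \<cdot> assoc C X Y Z"
    and lunit_Hom: "X \<in> Obj C \<Longrightarrow> lunit C X \<in> Hom C (\<one> \<otimes> X) X"
    and lunit_iso: "X \<in> Obj C \<Longrightarrow> is_iso C (lunit C X)"
    and lunit_natural: "f \<in> Hom C X X'
          \<Longrightarrow> lunit C X' \<cdot> (Id C \<one> \<otimes>\<^sub>a f) = f \<cdot> lunit C X"
    and runit_Hom: "X \<in> Obj C \<Longrightarrow> runit C X \<in> Hom C (X \<otimes> \<one>) X"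
    and runit_iso: "X \<in> Obj C \<Longrightarrow> is_iso C (runit C X)"
    and runit_natural: "f \<in> Hom C X X'
          \<Longrightarrow> runit C X' \<cdot> (f \<otimes>\<^sub>a Id C \<one>) = f \<cdot> runit C X"
    and pentagon: "\<lbrakk>W \<in> Obj C; X \<in> Obj C; Y \<in> Obj C; Z \<in> Obj C\<rbrakk>
          \<Longrightarrow> assoc C W X (Y \<otimes> Z) \<cdot> assoc C (W \<otimes> X) Y Z
              = (Id C W \<otimes>\<^sub>a assoc C X Y Z) \<cdot>
                (assoc C W (X \<otimes> Y) Z \<cdot> (assoc C W X Y \<otimes>\<^sub>a Id C Z))"
    and triangle: "\<lbrakk>X \<in> Obj C; Y \<in> Obj C\<rbrakk>
          \<Longrightarrow> (Id C X \<otimes>\<^sub>a lunit C Y) \<cdot> assoc C X \<one> Y = runit C X \<otimes>\<^sub>a Id C Y"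

definition is_pre_dual ::
  "('o, 'a, 'x) monoidal_category_scheme \<Rightarrow> 'o \<Rightarrow> 'o \<Rightarrow> 'a \<Rightarrow> bool" where
  "is_pre_dual C X X' ev \<longleftrightarrow>
     X' \<in> Obj C \<and>
     ev \<in> Hom C (X' \<otimes>\<^bsub>C\<^esub> X) \<one>\<^bsub>C\<^esub> \<and>
     (\<forall>T \<in> Obj C. bij_betw (\<lambda>u. ev \<cdot>\<^bsub>C\<^esub> (u \<otimes>\<^sub>a\<^bsub>C\<^esub> Id C X))
                     (Hom C T X') (Hom C (T \<otimes>\<^bsub>C\<^esub> X) \<one>\<^bsub>C\<^esub>))"

locale pre_rigid_category = monoidal_category +
  assumes pre_rigid: "X \<in> Obj C \<Longrightarrow> \<exists>X' ev. is_pre_dual C X X' ev"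

section \<open>The functor category with its pointwise monoidal structure\<close>

definition functor_category ::
  "('i, 'j, 'x) category_scheme \<Rightarrow> ('o, 'a, 'y) monoidal_category_scheme \<Rightarrow>
   (('i, 'j, 'o, 'a) cat_functor, ('i, 'j, 'o, 'a) nat_trans) monoidal_category" where
  "functor_category J C =
     (let tens = (\<lambda>F G. Functor (\<lambda>x\<in>Obj J. omap F x \<otimes>\<^bsub>C\<^esub> omap G x)
                                (\<lambda>f\<in>Arr J. amap F f \<otimes>\<^sub>a\<^bsub>C\<^esub> amap G f));
          unit = Functor (\<lambda>x\<in>Obj J. \<one>\<^bsub>C\<^esub>) (\<lambda>f\<in>Arr J. Id C \<one>\<^bsub>C\<^esub>)
      in
      \<lparr> Obj = {F. is_functor J C F},
        Arr = {t. is_nat_trans J C t},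
        Dom = source,
        Cod = target,
        Id = (\<lambda>F. NatTrans F F (\<lambda>x\<in>Obj J. Id C (omap F x))),
        Comp = (\<lambda>t s. NatTrans (source s) (target t)
                        (\<lambda>x\<in>Obj J. component t x \<cdot>\<^bsub>C\<^esub> component s x)),
        TensO = tens,
        TensA = (\<lambda>s t. NatTrans (tens (source s) (source t)) (tens (target s) (target t))
                        (\<lambda>x\<in>Obj J. component s x \<otimes>\<^sub>a\<^bsub>C\<^esub> component t x)),
        Unit = unit,
        assoc = (\<lambda>F G H. NatTrans (tens (tens F G) H) (tens F (tens G H))
                        (\<lambda>x\<in>Obj J. assoc C (omap F x) (omap G x) (omap H x))),
        lunit = (\<lambda>F. NatTrans (tens unit F) F (\<lambda>x\<in>Obj J. lunit C (omap F x))),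
        runit = (\<lambda>F. NatTrans (tens F unit) F (\<lambda>x\<in>Obj J. runit C (omap F x))) \<rparr>)"

end

(* The unit of the functor category is constant, so by pre-rigidity of C a morphism from the tensor
   product of T and F to the unit amounts to arrows s y : T y --> (F y)^* such that
   (F f)^* (s y') (T f) = s y for every f : y --> y'. These are represented pointwise by
   F^*(x) = lim (F y)^*, the limit being over the opposite of the category of arrows u : x --> y:
   the arrow T x --> F^*(x) has u-component (s y)(T u). The evaluation at x is ev_{F x} applied to
   the projection of F^*(x) at the identity of x. *)

theory Submission
  imports Defs
begin

section \<open>Limits indexed by small categories of arbitrary type\<close>

text \<open>Taking duals pointwise fails because transposition reverses arrows: x |-> dual of F x is
  a functor on the opposite index category. The limit repairs the variance, since x enters it only
  through the arrows u leaving x, on which g : x --> y acts by u |-> u g. The formula is that of the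
  internal hom in a functor category: the end over y of the power of the internal hom from F y by
  the set of arrows x --> y. The target being the unit functor, duals are the only internal homs of
  C that it asks for. A second obstacle is size. Completeness provides limits for index categories
  with objects and arrows in the type of \<kappa>, whereas the limit taken here is indexed by arrows
  and pairs of arrows. There are fewer than \<kappa> such pairs because \<kappa> is infinite, and
  the limit is found over a relabelled copy.\<close>

lemma (in category) Id_closed [simp]:
  assumes "X \<in> Obj C"
  shows "Id C X \<in> Arr C" "Dom C (Id C X) = X" "Cod C (Id C X) = X"
  using Id_Hom[OF assms] by (auto simp: Hom_def)

lemma (in category) Comp_closed:
  assumes "f \<in> Arr C" "g \<in> Arr C" "Cod C f = Dom C g"
  shows "g \<cdot> f \<in> Arr C" "Dom C (g \<cdot> f) = Dom C f" "Cod C (g \<cdot> f) = Cod C g"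
  using Comp_Hom[of f "Dom C f" "Cod C f" g "Cod C g"] assms by (auto simp: Hom_def)

lemma (in category) Comp_Id_Arr: "f \<in> Arr C \<Longrightarrow> Dom C f = X \<Longrightarrow> f \<cdot> Id C X = f"
  and Id_Comp_Arr: "f \<in> Arr C \<Longrightarrow> Cod C f = Y \<Longrightarrow> Id C Y \<cdot> f = f"
  by (auto intro!: Comp_Id Id_Comp simp: Hom_def)

lemma (in category) Comp_assoc_Arr:
  assumes "f \<in> Arr C" "g \<in> Arr C" "h \<in> Arr C" "Cod C f = Dom C g" "Cod C g = Dom C h"
  shows "(h \<cdot> g) \<cdot> f = h \<cdot> (g \<cdot> f)"
  using Comp_assoc[of f "Dom C f" "Cod C f" g "Cod C g" h "Cod C h"] assms by (auto simp: Hom_def)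

lemma is_functorD:
  assumes "is_functor J C F"
  shows "omap F \<in> extensional (Obj J)"
    and "amap F \<in> extensional (Arr J)"
    and "x \<in> Obj J \<Longrightarrow> omap F x \<in> Obj C"
    and "x \<in> Obj J \<Longrightarrow> amap F (Id J x) = Id C (omap F x)"
    and "\<lbrakk>f \<in> Arr J; g \<in> Arr J; Cod J f = Dom J g\<rbrakk>
          \<Longrightarrow> amap F (g \<cdot>\<^bsub>J\<^esub> f) = amap F g \<cdot>\<^bsub>C\<^esub> amap F f"
  using assms by (auto simp: is_functor_def)

lemma (in category) functor_amap_Hom:
  assumes "is_functor C D F" "f \<in> Arr C"
  shows "amap F f \<in> Hom D (omap F (Dom C f)) (omap F (Cod C f))"
  using assms Dom_closed[OF assms(2)] Cod_closed[OF assms(2)] by (simp add: is_functor_def Hom_def)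

lemma small_inj:
  fixes \<kappa> :: "'u rel"
  assumes "Card_order \<kappa>" "|A| <o \<kappa>"
  shows "\<exists>f :: 'b \<Rightarrow> 'u. inj_on f A"
proof -
  have "|A| \<le>o |Field \<kappa>|"
    using assms
    by (meson card_of_Field_ordIso ordIso_symmetric ordLeq_ordIso_trans ordLess_imp_ordLeq)
  then show ?thesis by (auto simp: card_of_ordLeq[symmetric])
qed

text \<open>\<open>complete\<close> speaks of index categories over \<open>'u\<close> only.
  Injections of both carriers into \<open>'u\<close> give a copy \<open>K\<close> of
  \<open>J\<close>; limits survive the relabelling because apex and mediating arrows live in
  \<open>C\<close>.\<close>

lemma complete_imp_limit:
  fixes J :: "('p, 'q, 'x) category_scheme" and \<kappa> :: "'u rel"
  assumes "complete \<kappa> C" and "Card_order \<kappa>"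
    and J: "small_category J \<kappa>" and D: "is_functor J C D"
  shows "\<exists>L p. is_limit J C D L p"
proof -
  interpret J: small_category J \<kappa> by (rule J)
  obtain \<phi> :: "'p \<Rightarrow> 'u" where \<phi>: "inj_on \<phi> (Obj J)" using small_inj[OF assms(2) J.small_Obj] by blast
  obtain \<psi> :: "'q \<Rightarrow> 'u" where \<psi>: "inj_on \<psi> (Arr J)" using small_inj[OF assms(2) J.small_Arr] by blast
  define \<phi>' where "\<phi>' = the_inv_into (Obj J) \<phi>"
  define \<psi>' where "\<psi>' = the_inv_into (Arr J) \<psi>"
  have [simp]: "\<phi>' (\<phi> x) = x" if "x \<in> Obj J" for x
    using that \<phi> by (simp add: \<phi>'_def the_inv_into_f_f)
  have [simp]: "\<psi>' (\<psi> x) = x" if "x \<in> Arr J" for x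
    using that \<psi> by (simp add: \<psi>'_def the_inv_into_f_f)
  have [simp]: "\<phi> x = \<phi> y \<longleftrightarrow> x = y" if "x \<in> Obj J" "y \<in> Obj J" for x y
    using that \<phi> by (auto dest: inj_onD)
  define K :: "('u, 'u) category" where
    "K = \<lparr>Obj = \<phi> ` Obj J, Arr = \<psi> ` Arr J, Dom = \<lambda>f. \<phi> (Dom J (\<psi>' f)),
          Cod = \<lambda>f. \<phi> (Cod J (\<psi>' f)), Id = \<lambda>x. \<psi> (Id J (\<phi>' x)),
          Comp = \<lambda>g f. \<psi> (\<psi>' g \<cdot>\<^bsub>J\<^esub> \<psi>' f)\<rparr>"
  have K: "category K"
    by unfold_locales
      (auto simp: K_def Hom_def J.Dom_closed J.Cod_closed J.Comp_closed J.Comp_Id_Arr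
        J.Id_Comp_Arr J.Comp_assoc_Arr)
  have "small_category K \<kappa>"
    using K J.small_Obj J.small_Arr
    by (auto simp: small_category_def small_category_axioms_def K_def
        intro: card_of_image ordLeq_ordLess_trans)
  moreover define E where
    "E = Functor (\<lambda>x\<in>Obj K. omap D (\<phi>' x)) (\<lambda>f\<in>Arr K. amap D (\<psi>' f))"
  have "is_functor K C E"
    using D by (auto simp: is_functor_def E_def K_def Hom_def J.Dom_closed J.Cod_closed J.Comp_closed)
  ultimately obtain L p where L: "is_limit K C E L p"
    using assms(1) unfolding complete_def by blast
  have cone: "is_cone K C E M q \<longleftrightarrow> is_cone J C D M (q \<circ> \<phi>)" for M q
    by (auto simp: is_cone_def E_def K_def J.Dom_closed J.Cod_closed)
  have "is_limit J C D L (p \<circ> \<phi>)"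
    unfolding is_limit_def
  proof (intro conjI allI impI)
    show "is_cone J C D L (p \<circ> \<phi>)" using L cone by (auto simp: is_limit_def)
    fix M q assume "is_cone J C D M q"
    \<comment> \<open>The competing cone is indexed by the original objects, so it is moved to
      \<open>K\<close> along the inverse \<open>\<phi>'\<close> before the universal property
      applies.\<close>
    then have "is_cone K C E M (q \<circ> \<phi>')"
      by (auto simp: is_cone_def E_def K_def J.Dom_closed J.Cod_closed)
    then have "\<exists>!h. h \<in> Hom C M L \<and> (\<forall>x\<in>Obj K. p x \<cdot>\<^bsub>C\<^esub> h = (q \<circ> \<phi>') x)"
      using L unfolding is_limit_def by blast
    then show "\<exists>!h. h \<in> Hom C M L \<and> (\<forall>x\<in>Obj J. (p \<circ> \<phi>) x \<cdot>\<^bsub>C\<^esub> h = q x)"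
      by (simp add: K_def)
  qed
  then show ?thesis by blast
qed

section \<open>The pointwise monoidal structure\<close>

text \<open>The rules for arrows keep tensor products of functors folded. Unfolding one of them
  alone leaves the endpoints in the form in which the \<open>Hom\<close> statements below give
  them.\<close>

lemma functor_category_simps:
  "Obj (functor_category J C) = {F. is_functor J C F}"
  "Arr (functor_category J C) = {t. is_nat_trans J C t}"
  "Dom (functor_category J C) = source"
  "Cod (functor_category J C) = target"
  "Id (functor_category J C) F = NatTrans F F (\<lambda>x\<in>Obj J. Id C (omap F x))"
  "t \<cdot>\<^bsub>functor_category J C\<^esub> s =
     NatTrans (source s) (target t) (\<lambda>x\<in>Obj J. component t x \<cdot>\<^bsub>C\<^esub> component s x)"
  "F \<otimes>\<^bsub>functor_category J C\<^esub> G =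
     Functor (\<lambda>x\<in>Obj J. omap F x \<otimes>\<^bsub>C\<^esub> omap G x) (\<lambda>f\<in>Arr J. amap F f \<otimes>\<^sub>a\<^bsub>C\<^esub> amap G f)"
  "s \<otimes>\<^sub>a\<^bsub>functor_category J C\<^esub> t =
     NatTrans (source s \<otimes>\<^bsub>functor_category J C\<^esub> source t)
       (target s \<otimes>\<^bsub>functor_category J C\<^esub> target t)
       (\<lambda>x\<in>Obj J. component s x \<otimes>\<^sub>a\<^bsub>C\<^esub> component t x)"
  "\<one>\<^bsub>functor_category J C\<^esub> = Functor (\<lambda>x\<in>Obj J. \<one>\<^bsub>C\<^esub>) (\<lambda>f\<in>Arr J. Id C \<one>\<^bsub>C\<^esub>)"
  "assoc (functor_category J C) F G H =
     NatTrans ((F \<otimes>\<^bsub>functor_category J C\<^esub> G) \<otimes>\<^bsub>functor_category J C\<^esub> H)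
       (F \<otimes>\<^bsub>functor_category J C\<^esub> (G \<otimes>\<^bsub>functor_category J C\<^esub> H))
       (\<lambda>x\<in>Obj J. assoc C (omap F x) (omap G x) (omap H x))"
  "lunit (functor_category J C) F =
     NatTrans (\<one>\<^bsub>functor_category J C\<^esub> \<otimes>\<^bsub>functor_category J C\<^esub> F) F
       (\<lambda>x\<in>Obj J. lunit C (omap F x))"
  "runit (functor_category J C) F =
     NatTrans (F \<otimes>\<^bsub>functor_category J C\<^esub> \<one>\<^bsub>functor_category J C\<^esub>) F
       (\<lambda>x\<in>Obj J. runit C (omap F x))"
  by (simp_all add: functor_category_def Let_def)

text \<open>A shared \<open>Hom\<close> set fixes source and target, and components are extensional,
  so agreement on objects already gives HOL equality. Equations in the functor category are reduced
  to \<open>C\<close> by this rule.\<close>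

lemma nat_trans_eqI:
  assumes "s \<in> Hom (functor_category J C) F G" "t \<in> Hom (functor_category J C) F G"
    and "\<And>x. x \<in> Obj J \<Longrightarrow> component s x = component t x"
  shows "s = t"
proof -
  have "component s = component t"
    using assms by (intro extensionalityI[of _ "Obj J"])
      (auto simp: Hom_def functor_category_simps is_nat_trans_def)
  then show ?thesis
    using assms by (intro nat_trans.expand) (auto simp: Hom_def functor_category_simps)
qed

lemma nat_transD:
  assumes "t \<in> Hom (functor_category J C) F G"
  shows "is_functor J C F" "is_functor J C G" "source t = F" "target t = G"
    "x \<in> Obj J \<Longrightarrow> component t x \<in> Hom C (omap F x) (omap G x)"
    "f \<in> Arr J \<Longrightarrow> component t (Cod J f) \<cdot>\<^bsub>C\<^esub> amap F f = amap G f \<cdot>\<^bsub>C\<^esub> component t (Dom J f)"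
  using assms by (auto simp: Hom_def functor_category_simps is_nat_trans_def)

section \<open>Identities, composites and tensor products of natural transformations\<close>

locale index_category = J: category J + C: monoidal_category C
  for J :: "('i, 'j, 'x) category_scheme" and C :: "('o, 'a, 'y) monoidal_category_scheme"
begin

abbreviation FC where "FC \<equiv> functor_category J C"

lemma nat_transI:
  assumes "is_functor J C F" "is_functor J C G"
    and "\<And>x. x \<in> Obj J \<Longrightarrow> c x \<in> Hom C (omap F x) (omap G x)"
    and "\<And>f. f \<in> Arr J \<Longrightarrow> c (Cod J f) \<cdot>\<^bsub>C\<^esub> amap F f = amap G f \<cdot>\<^bsub>C\<^esub> c (Dom J f)"
  shows "NatTrans F G (\<lambda>x\<in>Obj J. c x) \<in> Hom FC F G"
  using assms
  by (auto simp: Hom_def functor_category_simps is_nat_trans_def J.Dom_closed J.Cod_closed)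

lemma tensor_functor:
  assumes F: "is_functor J C F" and G: "is_functor J C G"
  shows "is_functor J C (F \<otimes>\<^bsub>FC\<^esub> G)"
proof -
  have "amap F (g \<cdot>\<^bsub>J\<^esub> f) \<otimes>\<^sub>a\<^bsub>C\<^esub> amap G (g \<cdot>\<^bsub>J\<^esub> f) =
      (amap F g \<otimes>\<^sub>a\<^bsub>C\<^esub> amap G g) \<cdot>\<^bsub>C\<^esub> (amap F f \<otimes>\<^sub>a\<^bsub>C\<^esub> amap G f)"
    if "f \<in> Arr J" "g \<in> Arr J" "Cod J f = Dom J g" for f g
    using that C.TensA_Comp[OF J.functor_amap_Hom[OF F, of f] _ J.functor_amap_Hom[OF G, of f]]
      J.functor_amap_Hom[OF F, of g] J.functor_amap_Hom[OF G, of g]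
    by (simp add: is_functorD(5)[OF F] is_functorD(5)[OF G])
  then show ?thesis
    using F G
    by (auto simp: is_functor_def functor_category_simps Hom_def[of J] C.TensO_closed C.TensA_Id
        J.Comp_closed intro!: C.TensA_Hom)
qed

lemma unit_functor: "is_functor J C \<one>\<^bsub>FC\<^esub>"
  using C.Unit_closed
  by (auto simp: is_functor_def functor_category_simps Hom_def[of J] J.Comp_closed C.Id_Hom
      C.Comp_Id[OF C.Id_Hom])

lemma Id_nat_trans: "is_functor J C F \<Longrightarrow> Id FC F \<in> Hom FC F F"
  unfolding functor_category_simps
  by (rule nat_transI)
    (auto simp: is_functorD C.Id_Hom C.Comp_Id[OF J.functor_amap_Hom] C.Id_Comp[OF J.functor_amap_Hom])

lemma Comp_nat_trans:
  assumes s: "s \<in> Hom FC F G" and t: "t \<in> Hom FC G H"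
  shows "t \<cdot>\<^bsub>FC\<^esub> s \<in> Hom FC F H"
  unfolding functor_category_simps nat_transD(3)[OF s] nat_transD(4)[OF t]
proof (rule nat_transI)
  note [simp] = J.Dom_closed J.Cod_closed
  fix f assume f: "f \<in> Arr J"
  note Ff = J.functor_amap_Hom[OF _ f] and S = nat_transD[OF s] and T = nat_transD[OF t]
  have "(component t (Cod J f) \<cdot>\<^bsub>C\<^esub> component s (Cod J f)) \<cdot>\<^bsub>C\<^esub> amap F f
      = component t (Cod J f) \<cdot>\<^bsub>C\<^esub> (component s (Cod J f) \<cdot>\<^bsub>C\<^esub> amap F f)"
    using f by (intro C.Comp_assoc[OF Ff S(5) T(5)]) (auto intro: S)
  also have "\<dots> = component t (Cod J f) \<cdot>\<^bsub>C\<^esub> (amap G f \<cdot>\<^bsub>C\<^esub> component s (Dom J f))"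
    by (simp add: S(6) f)
  also have "\<dots> = (component t (Cod J f) \<cdot>\<^bsub>C\<^esub> amap G f) \<cdot>\<^bsub>C\<^esub> component s (Dom J f)"
    using f by (intro C.Comp_assoc[OF S(5) Ff T(5), symmetric]) (auto intro: S)
  also have "\<dots> = (amap H f \<cdot>\<^bsub>C\<^esub> component t (Dom J f)) \<cdot>\<^bsub>C\<^esub> component s (Dom J f)"
    by (simp add: T(6) f)
  also have "\<dots> = amap H f \<cdot>\<^bsub>C\<^esub> (component t (Dom J f) \<cdot>\<^bsub>C\<^esub> component s (Dom J f))"
    using f by (intro C.Comp_assoc[OF S(5) T(5) Ff]) (auto intro: T)
  finally show "(component t (Cod J f) \<cdot>\<^bsub>C\<^esub> component s (Cod J f)) \<cdot>\<^bsub>C\<^esub> amap F f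
      = amap H f \<cdot>\<^bsub>C\<^esub> (component t (Dom J f) \<cdot>\<^bsub>C\<^esub> component s (Dom J f))" .
qed (use nat_transD[OF s] nat_transD[OF t] in \<open>auto intro: C.Comp_Hom\<close>)

lemma TensA_nat_trans:
  assumes s: "s \<in> Hom FC F F'" and t: "t \<in> Hom FC G G'"
  shows "s \<otimes>\<^sub>a\<^bsub>FC\<^esub> t \<in> Hom FC (F \<otimes>\<^bsub>FC\<^esub> G) (F' \<otimes>\<^bsub>FC\<^esub> G')"
  unfolding functor_category_simps(8) nat_transD(3,4)[OF s] nat_transD(3,4)[OF t]
proof (rule nat_transI)
  note [simp] = J.Dom_closed J.Cod_closed
  note S = nat_transD[OF s] and T = nat_transD[OF t]
  show "is_functor J C (F \<otimes>\<^bsub>FC\<^esub> G)" "is_functor J C (F' \<otimes>\<^bsub>FC\<^esub> G')"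
    by (auto intro: tensor_functor S T)
  show "component s x \<otimes>\<^sub>a\<^bsub>C\<^esub> component t x \<in> Hom C (omap (F \<otimes>\<^bsub>FC\<^esub> G) x) (omap (F' \<otimes>\<^bsub>FC\<^esub> G') x)"
    if "x \<in> Obj J" for x
    using that S T by (auto simp: functor_category_simps intro: C.TensA_Hom)
  fix f assume f: "f \<in> Arr J"
  note Ff = J.functor_amap_Hom[OF _ f]
  have "(component s (Cod J f) \<otimes>\<^sub>a\<^bsub>C\<^esub> component t (Cod J f)) \<cdot>\<^bsub>C\<^esub> (amap F f \<otimes>\<^sub>a\<^bsub>C\<^esub> amap G f)
     = (component s (Cod J f) \<cdot>\<^bsub>C\<^esub> amap F f) \<otimes>\<^sub>a\<^bsub>C\<^esub> (component t (Cod J f) \<cdot>\<^bsub>C\<^esub> amap G f)"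
    using f by (intro C.TensA_Comp[OF Ff S(5) Ff T(5), symmetric]) (auto intro: S T)
  also have "\<dots> = (amap F' f \<cdot>\<^bsub>C\<^esub> component s (Dom J f)) \<otimes>\<^sub>a\<^bsub>C\<^esub> (amap G' f \<cdot>\<^bsub>C\<^esub> component t (Dom J f))"
    by (simp add: S(6) T(6) f)
  also have "\<dots> = (amap F' f \<otimes>\<^sub>a\<^bsub>C\<^esub> amap G' f) \<cdot>\<^bsub>C\<^esub> (component s (Dom J f) \<otimes>\<^sub>a\<^bsub>C\<^esub> component t (Dom J f))"
    using f by (intro C.TensA_Comp[OF S(5) Ff T(5) Ff]) (auto intro: S T)
  finally show "(component s (Cod J f) \<otimes>\<^sub>a\<^bsub>C\<^esub> component t (Cod J f)) \<cdot>\<^bsub>C\<^esub> amap (F \<otimes>\<^bsub>FC\<^esub> G) f =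
      amap (F' \<otimes>\<^bsub>FC\<^esub> G') f \<cdot>\<^bsub>C\<^esub> (component s (Dom J f) \<otimes>\<^sub>a\<^bsub>C\<^esub> component t (Dom J f))"
    using f by (simp add: functor_category_simps)
qed

lemma category_FC: "category FC"
proof
  show "f \<cdot>\<^bsub>FC\<^esub> Id FC X = f" if "f \<in> Hom FC X Y" for f X Y
    by (rule nat_trans_eqI[OF Comp_nat_trans[OF Id_nat_trans[OF nat_transD(1)[OF that]] that] that])
      (simp add: functor_category_simps nat_transD(3,4)[OF that] C.Comp_Id[OF nat_transD(5)[OF that]])
  show "Id FC Y \<cdot>\<^bsub>FC\<^esub> f = f" if "f \<in> Hom FC X Y" for f X Y
    by (rule nat_trans_eqI[OF Comp_nat_trans[OF that Id_nat_trans[OF nat_transD(2)[OF that]]] that])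
      (simp add: functor_category_simps nat_transD(3,4)[OF that] C.Id_Comp[OF nat_transD(5)[OF that]])
  show "(h \<cdot>\<^bsub>FC\<^esub> g) \<cdot>\<^bsub>FC\<^esub> f = h \<cdot>\<^bsub>FC\<^esub> (g \<cdot>\<^bsub>FC\<^esub> f)"
    if f: "f \<in> Hom FC W X" and g: "g \<in> Hom FC X Y" and h: "h \<in> Hom FC Y Z" for f g h W X Y Z
    by (rule nat_trans_eqI[OF Comp_nat_trans[OF f Comp_nat_trans[OF g h]]
          Comp_nat_trans[OF Comp_nat_trans[OF f g] h]])
      (use C.Comp_assoc[OF nat_transD(5)[OF f] nat_transD(5)[OF g] nat_transD(5)[OF h]]
        in \<open>auto simp: functor_category_simps\<close>)
qed (auto intro: Comp_nat_trans simp: functor_category_simps(1) Id_nat_trans,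
    auto simp: functor_category_simps is_nat_trans_def)

text \<open>Naturality of the pointwise inverse is automatic: insert \<open>component t ?x\<close>
  after \<open>c ?x\<close>, carry \<open>t\<close> across its naturality square, and cancel it
  against \<open>c ?y\<close>.\<close>

lemma is_iso_pointwise:
  assumes t: "t \<in> Hom FC F G" and iso: "\<And>x. x \<in> Obj J \<Longrightarrow> is_iso C (component t x)"
  shows "is_iso FC t"
proof -
  note T = nat_transD[OF t]
  have "\<exists>g. g \<in> Hom C (omap G x) (omap F x) \<and> g \<cdot>\<^bsub>C\<^esub> component t x = Id C (omap F x)
      \<and> component t x \<cdot>\<^bsub>C\<^esub> g = Id C (omap G x)" if "x \<in> Obj J" for x
    using iso[OF that] T(5)[OF that] by (auto simp: is_iso_def Hom_def)
  then obtain c where c: "\<And>x. x \<in> Obj J \<Longrightarrow> c x \<in> Hom C (omap G x) (omap F x)"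
    and l: "\<And>x. x \<in> Obj J \<Longrightarrow> c x \<cdot>\<^bsub>C\<^esub> component t x = Id C (omap F x)"
    and r: "\<And>x. x \<in> Obj J \<Longrightarrow> component t x \<cdot>\<^bsub>C\<^esub> c x = Id C (omap G x)"
    by metis
  have s: "NatTrans G F (\<lambda>x\<in>Obj J. c x) \<in> Hom FC G F" (is "?s \<in> _")
  proof (rule nat_transI[OF T(2,1) c])
    fix f assume f: "f \<in> Arr J"
    then have [simp]: "Dom J f \<in> Obj J" "Cod J f \<in> Obj J" by (auto simp: J.Dom_closed J.Cod_closed)
    note Ff = J.functor_amap_Hom[OF T(1) f] and Gf = J.functor_amap_Hom[OF T(2) f]
    let ?x = "Dom J f" and ?y = "Cod J f"
    have "c ?y \<cdot>\<^bsub>C\<^esub> amap G f = c ?y \<cdot>\<^bsub>C\<^esub> (amap G f \<cdot>\<^bsub>C\<^esub> (component t ?x \<cdot>\<^bsub>C\<^esub> c ?x))"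
      by (simp add: r C.Comp_Id[OF Gf])
    also have "amap G f \<cdot>\<^bsub>C\<^esub> (component t ?x \<cdot>\<^bsub>C\<^esub> c ?x) = (amap G f \<cdot>\<^bsub>C\<^esub> component t ?x) \<cdot>\<^bsub>C\<^esub> c ?x"
      by (rule C.Comp_assoc[OF c T(5) Gf, symmetric]) auto
    also have "\<dots> = (component t ?y \<cdot>\<^bsub>C\<^esub> amap F f) \<cdot>\<^bsub>C\<^esub> c ?x" by (simp add: T(6) f)
    also have "\<dots> = component t ?y \<cdot>\<^bsub>C\<^esub> (amap F f \<cdot>\<^bsub>C\<^esub> c ?x)"
      by (rule C.Comp_assoc[OF c Ff T(5)]) auto
    also have "c ?y \<cdot>\<^bsub>C\<^esub> \<dots> = (c ?y \<cdot>\<^bsub>C\<^esub> component t ?y) \<cdot>\<^bsub>C\<^esub> (amap F f \<cdot>\<^bsub>C\<^esub> c ?x)"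
      by (rule C.Comp_assoc[OF C.Comp_Hom[OF c Ff] T(5) c, symmetric]) auto
    also have "\<dots> = amap F f \<cdot>\<^bsub>C\<^esub> c ?x"
      by (simp add: l C.Id_Comp[OF C.Comp_Hom[OF c Ff]])
    finally show "c ?y \<cdot>\<^bsub>C\<^esub> amap G f = amap F f \<cdot>\<^bsub>C\<^esub> c ?x" .
  qed
  have "?s \<cdot>\<^bsub>FC\<^esub> t = Id FC F"
    by (rule nat_trans_eqI[OF Comp_nat_trans[OF t s] Id_nat_trans[OF T(1)]])
      (simp add: functor_category_simps l)
  moreover have "t \<cdot>\<^bsub>FC\<^esub> ?s = Id FC G"
    by (rule nat_trans_eqI[OF Comp_nat_trans[OF s t] Id_nat_trans[OF T(2)]])
      (simp add: functor_category_simps r)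
  ultimately show ?thesis
    using s t T(3,4) by (auto simp: is_iso_def Hom_def functor_category_simps(2-4))
qed

section \<open>Associator, unitors and coherence laws\<close>

lemma assoc_nat_trans:
  assumes F: "is_functor J C F" and G: "is_functor J C G" and H: "is_functor J C H"
  shows "assoc FC F G H \<in> Hom FC ((F \<otimes>\<^bsub>FC\<^esub> G) \<otimes>\<^bsub>FC\<^esub> H) (F \<otimes>\<^bsub>FC\<^esub> (G \<otimes>\<^bsub>FC\<^esub> H))"
  unfolding functor_category_simps(10)
proof (rule nat_transI)
  show "is_functor J C ((F \<otimes>\<^bsub>FC\<^esub> G) \<otimes>\<^bsub>FC\<^esub> H)" "is_functor J C (F \<otimes>\<^bsub>FC\<^esub> G \<otimes>\<^bsub>FC\<^esub> H)"
    by (intro tensor_functor assms)+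
  show "assoc C (omap F (Cod J f)) (omap G (Cod J f)) (omap H (Cod J f)) \<cdot>\<^bsub>C\<^esub>
        amap ((F \<otimes>\<^bsub>FC\<^esub> G) \<otimes>\<^bsub>FC\<^esub> H) f =
      amap (F \<otimes>\<^bsub>FC\<^esub> G \<otimes>\<^bsub>FC\<^esub> H) f \<cdot>\<^bsub>C\<^esub>
        assoc C (omap F (Dom J f)) (omap G (Dom J f)) (omap H (Dom J f))" if "f \<in> Arr J" for f
    using that C.assoc_natural[OF J.functor_amap_Hom[OF F that] J.functor_amap_Hom[OF G that]
        J.functor_amap_Hom[OF H that]]
    by (simp add: functor_category_simps)
qed (use assms in \<open>auto simp: functor_category_simps(7) is_functorD(3) C.assoc_Hom\<close>)

lemma lunit_nat_trans:
  assumes F: "is_functor J C F"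
  shows "lunit FC F \<in> Hom FC (\<one>\<^bsub>FC\<^esub> \<otimes>\<^bsub>FC\<^esub> F) F"
  unfolding functor_category_simps(11)
  by (rule nat_transI[OF tensor_functor[OF unit_functor F] F])
    (auto simp: functor_category_simps is_functorD[OF F] C.lunit_Hom
      C.lunit_natural[OF J.functor_amap_Hom[OF F]])

lemma runit_nat_trans:
  assumes F: "is_functor J C F"
  shows "runit FC F \<in> Hom FC (F \<otimes>\<^bsub>FC\<^esub> \<one>\<^bsub>FC\<^esub>) F"
  unfolding functor_category_simps(12)
  by (rule nat_transI[OF tensor_functor[OF F unit_functor] F])
    (auto simp: functor_category_simps is_functorD[OF F] C.runit_Hom
      C.runit_natural[OF J.functor_amap_Hom[OF F]])

lemma monoidal_FC: "monoidal_category FC"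
proof -
  interpret FC: category FC by (rule category_FC)
  note [intro] = tensor_functor unit_functor Id_nat_trans Comp_nat_trans TensA_nat_trans
    assoc_nat_trans lunit_nat_trans runit_nat_trans
  note [simp] = nat_transD(5) is_functorD(3)
  show ?thesis
  \<comment> \<open>\<open>FC\<close> is already interpreted as a category, so the sixteen cases are
    the axioms of \<open>monoidal_category\<close> in order: tensor 1 to 4, unit object 5,
    associator 6 to 8, left unitor 9 to 11, right unitor 12 to 14, pentagon and triangle.\<close>
  proof (unfold_locales, goal_cases)
    case 1 then show ?case by (auto simp: functor_category_simps(1))
  next
    case 2 then show ?case by auto
  next
    case (3 F G)
    then have "is_functor J C F" "is_functor J C G" by (auto simp: functor_category_simps(1))
    then show ?case
      by (intro nat_trans_eqI[of _ J C "F \<otimes>\<^bsub>FC\<^esub> G" "F \<otimes>\<^bsub>FC\<^esub> G"])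
        (blast+, simp add: functor_category_simps C.TensA_Id)
  next
    case (4 f X X' f' X'' g Y Y' g' Y'')
    note h = nat_transD(5)[OF 4(1)] nat_transD(5)[OF 4(2)] nat_transD(5)[OF 4(3)] nat_transD(5)[OF 4(4)]
    show ?case
      by (rule nat_trans_eqI[of _ J C "X \<otimes>\<^bsub>FC\<^esub> Y" "X'' \<otimes>\<^bsub>FC\<^esub> Y''"])
        (use 4 in blast, use 4 in blast, use C.TensA_Comp[OF h] in \<open>simp add: functor_category_simps\<close>)
  next
    case 5 then show ?case by (auto simp: functor_category_simps(1))
  next
    case 6 then show ?case by (auto simp: functor_category_simps(1))
  next
    case (7 X Y Z)
    then show ?case
      by (intro is_iso_pointwise[OF assoc_nat_trans])
        (auto simp: functor_category_simps C.assoc_iso)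
  next
    case (8 f X X' g Y Y' h Z Z')
    note fn = 8[THEN nat_transD(1)] 8[THEN nat_transD(2)]
    show ?case
      by (rule nat_trans_eqI[of _ J C "(X \<otimes>\<^bsub>FC\<^esub> Y) \<otimes>\<^bsub>FC\<^esub> Z" "X' \<otimes>\<^bsub>FC\<^esub> (Y' \<otimes>\<^bsub>FC\<^esub> Z')"])
        (use 8 fn in blast, use 8 fn in blast,
          use C.assoc_natural[OF 8[THEN nat_transD(5)]] nat_transD(3,4)[OF 8(1)] nat_transD(3,4)[OF 8(2)]
            nat_transD(3,4)[OF 8(3)] in \<open>simp add: functor_category_simps\<close>)
  next
    case 9 then show ?case by (auto simp: functor_category_simps(1))
  next
    case (10 X)
    then show ?case
      by (intro is_iso_pointwise[OF lunit_nat_trans]) (auto simp: functor_category_simps C.lunit_iso)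
  next
    case (11 f X X')
    note fn = 11[THEN nat_transD(1)] 11[THEN nat_transD(2)]
    show ?case
      by (rule nat_trans_eqI[of _ J C "\<one>\<^bsub>FC\<^esub> \<otimes>\<^bsub>FC\<^esub> X" X'])
        (use 11 fn in blast, use 11 fn in blast,
          use C.lunit_natural[OF nat_transD(5)[OF 11]] nat_transD(3,4)[OF 11] in
            \<open>simp add: functor_category_simps\<close>)
  next
    case 12 then show ?case by (auto simp: functor_category_simps(1))
  next
    case (13 X)
    then show ?case
      by (intro is_iso_pointwise[OF runit_nat_trans]) (auto simp: functor_category_simps C.runit_iso)
  next
    case (14 f X X')
    note fn = 14[THEN nat_transD(1)] 14[THEN nat_transD(2)]
    show ?case
      by (rule nat_trans_eqI[of _ J C "X \<otimes>\<^bsub>FC\<^esub> \<one>\<^bsub>FC\<^esub>" X'])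
        (use 14 fn in blast, use 14 fn in blast,
          use C.runit_natural[OF nat_transD(5)[OF 14]] nat_transD(3,4)[OF 14] in
            \<open>simp add: functor_category_simps\<close>)
  next
    case (15 W X Y Z)
    then have fn: "is_functor J C W" "is_functor J C X" "is_functor J C Y" "is_functor J C Z"
      by (auto simp: functor_category_simps(1))
    show ?case
      by (rule nat_trans_eqI[of _ J C "((W \<otimes>\<^bsub>FC\<^esub> X) \<otimes>\<^bsub>FC\<^esub> Y) \<otimes>\<^bsub>FC\<^esub> Z"
            "W \<otimes>\<^bsub>FC\<^esub> (X \<otimes>\<^bsub>FC\<^esub> (Y \<otimes>\<^bsub>FC\<^esub> Z))"])
        (use fn in blast, use fn in blast,
          use fn in \<open>simp add: functor_category_simps C.pentagon\<close>)
  next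
    case (16 X Y)
    then have fn: "is_functor J C X" "is_functor J C Y"
      by (auto simp: functor_category_simps(1))
    show ?case
      by (rule nat_trans_eqI[of _ J C "(X \<otimes>\<^bsub>FC\<^esub> \<one>\<^bsub>FC\<^esub>) \<otimes>\<^bsub>FC\<^esub> Y" "X \<otimes>\<^bsub>FC\<^esub> Y"])
        (use fn in blast, use fn in blast,
          use fn in \<open>simp add: functor_category_simps C.triangle\<close>)
  qed
qed

end

section \<open>Duals in a pre-rigid category\<close>

context pre_rigid_category
begin

text \<open>Choosing the object first, among those admitting some evaluation, lets \<open>ev\<close>
  be chosen for that same object.\<close>

definition "dual X = (SOME X'. \<exists>e. is_pre_dual C X X' e)"

definition "ev X = (SOME e. is_pre_dual C X (dual X) e)"

lemma is_pre_dual_dual: "X \<in> Obj C \<Longrightarrow> is_pre_dual C X (dual X) (ev X)"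
  unfolding ev_def by (rule someI_ex) (unfold dual_def, rule someI_ex, rule pre_rigid)

lemma dual_closed: "X \<in> Obj C \<Longrightarrow> dual X \<in> Obj C"
  and ev_Hom: "X \<in> Obj C \<Longrightarrow> ev X \<in> Hom C (dual X \<otimes> X) \<one>"
  using is_pre_dual_dual by (auto simp: is_pre_dual_def)

text \<open>This is the surjective half of the pre-dual bijection. The injective half is
  \<open>ev_cancel\<close>, with which arrows into a dual are compared after evaluation.\<close>

lemma curry_exists:
  assumes "X \<in> Obj C" "T \<in> Obj C" "t \<in> Hom C (T \<otimes> X) \<one>"
  shows "\<exists>u \<in> Hom C T (dual X). ev X \<cdot> (u \<otimes>\<^sub>a Id C X) = t"
proof -
  have "t \<in> (\<lambda>u. ev X \<cdot> (u \<otimes>\<^sub>a Id C X)) ` Hom C T (dual X)"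
    using is_pre_dual_dual[OF assms(1)] assms(2,3) by (simp add: is_pre_dual_def bij_betw_def)
  then show ?thesis by blast
qed

lemma ev_cancel:
  assumes "X \<in> Obj C" "T \<in> Obj C" "u \<in> Hom C T (dual X)" "v \<in> Hom C T (dual X)"
    and "ev X \<cdot> (u \<otimes>\<^sub>a Id C X) = ev X \<cdot> (v \<otimes>\<^sub>a Id C X)"
  shows "u = v"
proof -
  have "inj_on (\<lambda>u. ev X \<cdot> (u \<otimes>\<^sub>a Id C X)) (Hom C T (dual X))"
    using is_pre_dual_dual[OF assms(1)] assms(2) by (simp add: is_pre_dual_def bij_betw_def)
  from inj_onD[OF this assms(5,3,4)] show ?thesis .
qed

text \<open>The transpose of \<open>f\<close>, which makes the pre-dual a contravariant functor. It
  exists by \<open>curry_exists\<close>, and \<open>ev_cancel\<close> makes the choice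
  unique.\<close>

definition "dual_arr f =
  (SOME g. g \<in> Hom C (dual (Cod C f)) (dual (Dom C f)) \<and>
     ev (Dom C f) \<cdot> (g \<otimes>\<^sub>a Id C (Dom C f)) = ev (Cod C f) \<cdot> (Id C (dual (Cod C f)) \<otimes>\<^sub>a f))"

lemma Hom_Obj: "f \<in> Hom C X Y \<Longrightarrow> X \<in> Obj C" "f \<in> Hom C X Y \<Longrightarrow> Y \<in> Obj C"
  by (auto simp: Hom_def Dom_closed Cod_closed)

lemma dual_arr:
  assumes f: "f \<in> Hom C X Y"
  shows dual_arr_Hom: "dual_arr f \<in> Hom C (dual Y) (dual X)"
    and ev_dual_arr_Id: "ev X \<cdot> (dual_arr f \<otimes>\<^sub>a Id C X) = ev Y \<cdot> (Id C (dual Y) \<otimes>\<^sub>a f)"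
proof -
  have X: "X \<in> Obj C" and Y: "Y \<in> Obj C" using Hom_Obj[OF f] by auto
  have [simp]: "Dom C f = X" "Cod C f = Y" using f by (auto simp: Hom_def)
  have "\<exists>g \<in> Hom C (dual Y) (dual X). ev X \<cdot> (g \<otimes>\<^sub>a Id C X) = ev Y \<cdot> (Id C (dual Y) \<otimes>\<^sub>a f)"
    using f X Y by (intro curry_exists) (auto intro: dual_closed Comp_Hom TensA_Hom Id_Hom ev_Hom)
  then have "\<exists>g. g \<in> Hom C (dual (Cod C f)) (dual (Dom C f)) \<and>
     ev (Dom C f) \<cdot> (g \<otimes>\<^sub>a Id C (Dom C f)) = ev (Cod C f) \<cdot> (Id C (dual (Cod C f)) \<otimes>\<^sub>a f)" by auto
  from someI_ex[OF this, folded dual_arr_def]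
  show "dual_arr f \<in> Hom C (dual Y) (dual X)"
    and "ev X \<cdot> (dual_arr f \<otimes>\<^sub>a Id C X) = ev Y \<cdot> (Id C (dual Y) \<otimes>\<^sub>a f)" by auto
qed

text \<open>By the interchange law \<open>v\<close> and \<open>h\<close> can be pulled out of the
  evaluation together, leaving the uncurried form of \<open>u\<close>.\<close>

lemma ev_Comp_tensor:
  assumes X: "X \<in> Obj C" and u: "u \<in> Hom C S (dual X)" and v: "v \<in> Hom C T S" and h: "h \<in> Hom C W X"
  shows "ev X \<cdot> ((u \<cdot> v) \<otimes>\<^sub>a h) = (ev X \<cdot> (u \<otimes>\<^sub>a Id C X)) \<cdot> (v \<otimes>\<^sub>a h)"
proof -
  have "(u \<cdot> v) \<otimes>\<^sub>a h = (u \<otimes>\<^sub>a Id C X) \<cdot> (v \<otimes>\<^sub>a h)"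
    using TensA_Comp[OF v u h Id_Hom[OF X]] Id_Comp[OF h] by simp
  then show ?thesis
    using Comp_assoc[OF TensA_Hom[OF v h] TensA_Hom[OF u Id_Hom[OF X]] ev_Hom[OF X]] by simp
qed

text \<open>Extranaturality of the evaluation: an arrow moves from the dual factor to the other one.
  The arrows \<open>u\<close> and \<open>h\<close> generalise the defining equation of the transpose
  so that moves can be chained.\<close>

lemma ev_dual_arr:
  assumes f: "f \<in> Hom C X Y" and u: "u \<in> Hom C T (dual Y)" and h: "h \<in> Hom C W X"
  shows "ev X \<cdot> ((dual_arr f \<cdot> u) \<otimes>\<^sub>a h) = ev Y \<cdot> (u \<otimes>\<^sub>a (f \<cdot> h))"
proof -
  have X: "X \<in> Obj C" and Y: "Y \<in> Obj C" using Hom_Obj[OF f] by auto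
  note I = Id_Hom[OF dual_closed[OF Y]]
  have "ev X \<cdot> ((dual_arr f \<cdot> u) \<otimes>\<^sub>a h) = (ev Y \<cdot> (Id C (dual Y) \<otimes>\<^sub>a f)) \<cdot> (u \<otimes>\<^sub>a h)"
    using ev_Comp_tensor[OF X dual_arr_Hom[OF f] u h] ev_dual_arr_Id[OF f] by simp
  also have "\<dots> = ev Y \<cdot> ((Id C (dual Y) \<otimes>\<^sub>a f) \<cdot> (u \<otimes>\<^sub>a h))"
    by (rule Comp_assoc[OF TensA_Hom[OF u h] TensA_Hom[OF I f] ev_Hom[OF Y]])
  also have "(Id C (dual Y) \<otimes>\<^sub>a f) \<cdot> (u \<otimes>\<^sub>a h) = u \<otimes>\<^sub>a (f \<cdot> h)"
    using TensA_Comp[OF u I h f] Id_Comp[OF u] by simp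
  finally show ?thesis .
qed

text \<open>At an identity, the defining equation of the transpose is literally the premise of
  \<open>ev_cancel\<close>.\<close>

lemma dual_arr_Id:
  assumes X: "X \<in> Obj C"
  shows "dual_arr (Id C X) = Id C (dual X)"
  by (rule ev_cancel[OF X dual_closed[OF X] dual_arr_Hom[OF Id_Hom[OF X]] Id_Hom[OF dual_closed[OF X]]
        ev_dual_arr_Id[OF Id_Hom[OF X]]])

text \<open>Moving first \<open>f\<close> and then \<open>g\<close> across the evaluation yields the
  equation that defines the transpose of the composite.\<close>

lemma dual_arr_Comp:
  assumes f: "f \<in> Hom C X Y" and g: "g \<in> Hom C Y Z"
  shows "dual_arr (g \<cdot> f) = dual_arr f \<cdot> dual_arr g"
proof -
  have X: "X \<in> Obj C" and Y: "Y \<in> Obj C" and Z: "Z \<in> Obj C" using Hom_Obj f g by auto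
  note gf = Comp_Hom[OF f g] and I = Id_Hom[OF dual_closed[OF Z]]
  have "ev X \<cdot> ((dual_arr f \<cdot> dual_arr g) \<otimes>\<^sub>a Id C X) = ev Y \<cdot> (dual_arr g \<otimes>\<^sub>a f)"
    using ev_dual_arr[OF f dual_arr_Hom[OF g] Id_Hom[OF X]] Comp_Id[OF f] by simp
  also have "\<dots> = ev Z \<cdot> (Id C (dual Z) \<otimes>\<^sub>a (g \<cdot> f))"
    using ev_dual_arr[OF g I f] Comp_Id[OF dual_arr_Hom[OF g]] by simp
  finally show ?thesis
    by (intro ev_cancel[OF X dual_closed[OF Z] dual_arr_Hom[OF gf]
          Comp_Hom[OF dual_arr_Hom[OF g] dual_arr_Hom[OF f]] trans[OF ev_dual_arr_Id[OF gf] sym]])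
qed

end

section \<open>The pre-dual of a functor\<close>

text \<open>
  The opposite of the category of arrows out of \<open>x\<close>: the pair \<open>(u, f)\<close> is the arrow from
  \<open>f \<cdot> u\<close> to \<open>u\<close>.
\<close>

definition coslice_op :: "('i, 'j, 'x) category_scheme \<Rightarrow> 'i \<Rightarrow> ('j, 'j \<times> 'j) category" where
  "coslice_op J x =
     \<lparr>Obj = {u \<in> Arr J. Dom J u = x},
      Arr = {(u, f). u \<in> Arr J \<and> f \<in> Arr J \<and> Dom J u = x \<and> Dom J f = Cod J u},
      Dom = (\<lambda>(u, f). f \<cdot>\<^bsub>J\<^esub> u), Cod = fst, Id = (\<lambda>u. (u, Id J (Cod J u))),
      Comp = (\<lambda>(u, f) (v, g). (u, g \<cdot>\<^bsub>J\<^esub> f))\<rparr>"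

lemma Hom_coslice_op:
  "a \<in> Hom (coslice_op J x) v w \<longleftrightarrow>
     fst a = w \<and> v = snd a \<cdot>\<^bsub>J\<^esub> w \<and> w \<in> Arr J \<and> snd a \<in> Arr J \<and> Dom J w = x \<and> Dom J (snd a) = Cod J w"
  by (cases a) (auto simp: Hom_def coslice_op_def)

text \<open>The second entries compose in reverse order because an arrow (u, f) runs against
  \<open>f\<close>.\<close>

lemma Comp_coslice_op: "b \<cdot>\<^bsub>coslice_op J x\<^esub> a = (fst b, snd a \<cdot>\<^bsub>J\<^esub> snd b)"
  and Id_coslice_op: "Id (coslice_op J x) u = (u, Id J (Cod J u))"
  by (simp_all add: coslice_op_def split_beta)

lemma (in category) category_coslice_op: "category (coslice_op C x)"
proof (unfold_locales, goal_cases)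
  case (1 f) then show ?case by (auto simp: coslice_op_def Comp_closed)
next
  case (2 f) then show ?case by (auto simp: coslice_op_def)
next
  case (3 u) then show ?case
    by (simp add: Hom_coslice_op) (simp add: coslice_op_def Cod_closed Id_Comp_Arr)
next
  case (4 f u v g w) then show ?case
    by (auto simp: Hom_coslice_op Comp_coslice_op Comp_closed Comp_assoc_Arr)
next
  case (5 f u v) then show ?case
    by (auto simp: Hom_coslice_op Comp_coslice_op Id_coslice_op Comp_closed Id_Comp_Arr prod_eq_iff)
next
  case (6 f u v) then show ?case
    by (auto simp: Hom_coslice_op Comp_coslice_op Id_coslice_op Comp_Id_Arr prod_eq_iff)
next
  case (7 f t u g v h w) then show ?case
    by (auto simp: Hom_coslice_op Comp_coslice_op Comp_closed Comp_assoc_Arr)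
qed

text \<open>The arrows are pairs of arrows, and an infinite \<kappa> leaves room for them: if
  \<open>Arr C\<close> is finite, so is its square; if it is infinite, the square has the same
  cardinality.\<close>

lemma (in small_category) small_coslice_op:
  assumes "Card_order \<kappa>" "cinfinite \<kappa>"
  shows "small_category (coslice_op C x) \<kappa>"
proof -
  have "|Arr C \<times> Arr C| <o \<kappa>"
  proof (cases "finite (Arr C)")
    case True
    then show ?thesis
      using assms(2)
      by (intro finite_ordLess_infinite[OF card_of_Well_order card_order_on_well_order_on[OF assms(1)]])
        (simp_all add: cinfinite_def Field_card_of)
  next
    case False
    then show ?thesis
      using card_of_Times_same_infinite small_Arr ordIso_ordLess_trans by blast
  qed
  moreover have "Arr (coslice_op C x) \<subseteq> Arr C \<times> Arr C" by (auto simp: coslice_op_def)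
  ultimately have "|Arr (coslice_op C x)| <o \<kappa>"
    by (meson card_of_mono1 ordLeq_ordLess_trans)
  moreover have "|Obj (coslice_op C x)| <o \<kappa>"
    by (rule ordLeq_ordLess_trans[OF card_of_mono1 small_Arr]) (auto simp: coslice_op_def)
  ultimately show ?thesis
    using category_coslice_op by (simp add: small_category_def small_category_axioms_def)
qed

locale pre_rigid_index = index_category J C + C: pre_rigid_category C
  for J :: "('i, 'j, 'x) category_scheme" and C :: "('o, 'a, 'y) monoidal_category_scheme"
begin

text \<open>Reversing the coslice offsets the contravariance of the dual: (u, f) leads from
  \<open>f \<cdot> u\<close> to \<open>u\<close>, and the transpose of F f leads from the dual at
  the codomain of \<open>f\<close> to the dual at the codomain of \<open>u\<close>.\<close>

definition dual_diagram :: "('i, 'j, 'o, 'a) cat_functor \<Rightarrow> 'i \<Rightarrow> ('j, 'j \<times> 'j, 'o, 'a) cat_functor" where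
  "dual_diagram F x =
     Functor (\<lambda>u\<in>Obj (coslice_op J x). C.dual (omap F (Cod J u)))
       (\<lambda>uf\<in>Arr (coslice_op J x). C.dual_arr (amap F (snd uf)))"

lemma dual_diagram_functor:
  assumes F: "is_functor J C F"
  shows "is_functor (coslice_op J x) C (dual_diagram F x)"
proof -
  note Ff = J.functor_amap_Hom[OF F]
  have Comp: "C.dual_arr (amap F (g \<cdot>\<^bsub>J\<^esub> f)) = C.dual_arr (amap F f) \<cdot>\<^bsub>C\<^esub> C.dual_arr (amap F g)"
    if "f \<in> Arr J" "g \<in> Arr J" "Cod J f = Dom J g" for f g
    using C.dual_arr_Comp[OF Ff[of f], of "amap F g"] Ff[of g] that
    by (simp add: is_functorD(5)[OF F])
  show ?thesis
    unfolding is_functor_def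
  proof (intro conjI ballI impI)
    fix v w uf assume "uf \<in> Hom (coslice_op J x) v w"
    then have "fst uf = w" "v = snd uf \<cdot>\<^bsub>J\<^esub> w" "w \<in> Arr J" "snd uf \<in> Arr J" "Dom J w = x"
      "Dom J (snd uf) = Cod J w"
      unfolding Hom_coslice_op by blast+
    then show "amap (dual_diagram F x) uf
        \<in> Hom C (omap (dual_diagram F x) v) (omap (dual_diagram F x) w)"
      using C.dual_arr_Hom[OF Ff, of "snd uf"]
      by (cases uf) (simp add: dual_diagram_def coslice_op_def J.Comp_closed)
  next
    fix a b assume "a \<in> Arr (coslice_op J x)" "b \<in> Arr (coslice_op J x)"
      and "Cod (coslice_op J x) a = Dom (coslice_op J x) b"
    \<comment> \<open>Composability equates the first entry of \<open>a\<close>, its codomain, with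
      the domain of \<open>b\<close>, which forces it to be the composite of \<open>u\<close> and
      \<open>g\<close>.\<close>
    then obtain u f g where ab: "a = (g \<cdot>\<^bsub>J\<^esub> u, f)" "b = (u, g)" "u \<in> Arr J" "f \<in> Arr J" "g \<in> Arr J"
      "Dom J u = x" "Dom J g = Cod J u" "Dom J f = Cod J g"
      by (cases a; cases b) (auto simp: coslice_op_def J.Comp_closed)
    then show "amap (dual_diagram F x) (b \<cdot>\<^bsub>coslice_op J x\<^esub> a) =
        amap (dual_diagram F x) b \<cdot>\<^bsub>C\<^esub> amap (dual_diagram F x) a"
      by (simp add: dual_diagram_def coslice_op_def J.Comp_closed Comp)
  qed (auto simp: dual_diagram_def coslice_op_def J.Cod_closed is_functorD(3,4)[OF F]
      C.dual_closed C.dual_arr_Id)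
qed

section \<open>The chosen limits and the arrows between them\<close>

context
  fixes F :: "('i, 'j, 'o, 'a) cat_functor" and L :: "'i \<Rightarrow> 'o" and p :: "'i \<Rightarrow> 'j \<Rightarrow> 'a"
  assumes F: "is_functor J C F"
    and limit: "\<And>x. x \<in> Obj J \<Longrightarrow> is_limit (coslice_op J x) C (dual_diagram F x) (L x) (p x)"
begin

lemma L_closed: "x \<in> Obj J \<Longrightarrow> L x \<in> Obj C"
  using limit by (auto simp: is_limit_def is_cone_def)

lemma p_Hom:
  assumes "u \<in> Arr J" "Dom J u = x" "Cod J u = y"
  shows "p x u \<in> Hom C (L x) (C.dual (omap F y))"
  using limit[of x] J.Dom_closed assms
  by (auto simp: is_limit_def is_cone_def dual_diagram_def coslice_op_def)

text \<open>This is the cone law of the limit at the arrow (u, f) of the reversed coslice.\<close>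

lemma dual_arr_p:
  assumes "u \<in> Arr J" "f \<in> Arr J" "Dom J u = x" "Dom J f = Cod J u"
  shows "C.dual_arr (amap F f) \<cdot>\<^bsub>C\<^esub> p x (f \<cdot>\<^bsub>J\<^esub> u) = p x u"
  using limit[of x] J.Dom_closed assms
  by (auto simp: is_limit_def is_cone_def dual_diagram_def coslice_op_def)

lemma p_universal:
  assumes "x \<in> Obj J" "M \<in> Obj C"
    and "\<And>u. u \<in> Arr J \<Longrightarrow> Dom J u = x \<Longrightarrow> q u \<in> Hom C M (C.dual (omap F (Cod J u)))"
    and "\<And>u f. \<lbrakk>u \<in> Arr J; f \<in> Arr J; Dom J u = x; Dom J f = Cod J u\<rbrakk>
      \<Longrightarrow> C.dual_arr (amap F f) \<cdot>\<^bsub>C\<^esub> q (f \<cdot>\<^bsub>J\<^esub> u) = q u"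
  shows "\<exists>!h. h \<in> Hom C M (L x) \<and> (\<forall>u \<in> Arr J. Dom J u = x \<longrightarrow> p x u \<cdot>\<^bsub>C\<^esub> h = q u)"
proof -
  have "is_cone (coslice_op J x) C (dual_diagram F x) M q"
    using assms by (auto simp: is_cone_def dual_diagram_def coslice_op_def)
  then have "\<exists>!h. h \<in> Hom C M (L x) \<and> (\<forall>u \<in> Obj (coslice_op J x). p x u \<cdot>\<^bsub>C\<^esub> h = q u)"
    using limit[OF assms(1)] unfolding is_limit_def by blast
  then show ?thesis by (simp add: coslice_op_def Ball_def imp_conjL)
qed

text \<open>The projections are jointly monic: composing them with \<open>h\<close> gives a cone,
  through which both \<open>h\<close> and \<open>h'\<close> factor.\<close>

lemma p_cancel:
  assumes x: "x \<in> Obj J" and h: "h \<in> Hom C M (L x)" and h': "h' \<in> Hom C M (L x)"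
    and eq: "\<And>u. u \<in> Arr J \<Longrightarrow> Dom J u = x \<Longrightarrow> p x u \<cdot>\<^bsub>C\<^esub> h = p x u \<cdot>\<^bsub>C\<^esub> h'"
  shows "h = h'"
proof -
  have "C.dual_arr (amap F f) \<cdot>\<^bsub>C\<^esub> (p x (f \<cdot>\<^bsub>J\<^esub> u) \<cdot>\<^bsub>C\<^esub> h) = p x u \<cdot>\<^bsub>C\<^esub> h"
    if "u \<in> Arr J" "f \<in> Arr J" "Dom J u = x" "Dom J f = Cod J u" for u f
    using C.Comp_assoc[OF h p_Hom C.dual_arr_Hom[OF J.functor_amap_Hom[OF F, of f]], of "f \<cdot>\<^bsub>J\<^esub> u"]
      that dual_arr_p[OF that] by (simp add: J.Comp_closed)
  then have "\<exists>!k. k \<in> Hom C M (L x) \<and> (\<forall>u \<in> Arr J. Dom J u = x \<longrightarrow> p x u \<cdot>\<^bsub>C\<^esub> k = p x u \<cdot>\<^bsub>C\<^esub> h)"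
    using x C.Hom_Obj(1)[OF h] by (intro p_universal) (auto intro: C.Comp_Hom[OF h] p_Hom)
  then show ?thesis using h h' eq by metis
qed

text \<open>Precomposition with \<open>g\<close> turns arrows out of its codomain into arrows out of
  its domain with the same codomain. The diagrams therefore agree along this reindexing, and
  \<open>dual_map g\<close> is the induced arrow of limits.\<close>

definition dual_map :: "'j \<Rightarrow> 'a" where
  "dual_map g = (THE h. h \<in> Hom C (L (Dom J g)) (L (Cod J g)) \<and>
     (\<forall>u \<in> Arr J. Dom J u = Cod J g \<longrightarrow> p (Cod J g) u \<cdot>\<^bsub>C\<^esub> h = p (Dom J g) (u \<cdot>\<^bsub>J\<^esub> g)))"

lemma dual_map:
  assumes g: "g \<in> Arr J" "Dom J g = x" "Cod J g = y"
  shows dual_map_Hom: "dual_map g \<in> Hom C (L x) (L y)"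
    and p_dual_map: "\<lbrakk>u \<in> Arr J; Dom J u = y\<rbrakk> \<Longrightarrow> p y u \<cdot>\<^bsub>C\<^esub> dual_map g = p x (u \<cdot>\<^bsub>J\<^esub> g)"
proof -
  \<comment> \<open>The reindexed projections form a cone: associativity reduces the law at (u, f)
    to \<open>dual_arr_p\<close> at (u g, f).\<close>
  have *: "C.dual_arr (amap F f) \<cdot>\<^bsub>C\<^esub> p x ((f \<cdot>\<^bsub>J\<^esub> u) \<cdot>\<^bsub>J\<^esub> g) = p x (u \<cdot>\<^bsub>J\<^esub> g)"
    if "u \<in> Arr J" "f \<in> Arr J" "Dom J u = y" "Dom J f = Cod J u" for u f
    using that g dual_arr_p[of "u \<cdot>\<^bsub>J\<^esub> g" f] by (simp add: J.Comp_closed J.Comp_assoc_Arr)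
  have "\<exists>!h. h \<in> Hom C (L x) (L y) \<and> (\<forall>u \<in> Arr J. Dom J u = y \<longrightarrow> p y u \<cdot>\<^bsub>C\<^esub> h = p x (u \<cdot>\<^bsub>J\<^esub> g))"
    by (rule p_universal)
      (use g * J.Dom_closed J.Cod_closed L_closed in \<open>auto simp: J.Comp_closed intro!: p_Hom\<close>)
  from theI'[OF this] g show "dual_map g \<in> Hom C (L x) (L y)"
    and "\<lbrakk>u \<in> Arr J; Dom J u = y\<rbrakk> \<Longrightarrow> p y u \<cdot>\<^bsub>C\<^esub> dual_map g = p x (u \<cdot>\<^bsub>J\<^esub> g)"
    by (auto simp: dual_map_def)
qed

definition dual_functor :: "('i, 'j, 'o, 'a) cat_functor" where
  "dual_functor = Functor (\<lambda>x\<in>Obj J. L x) (\<lambda>g\<in>Arr J. dual_map g)"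

text \<open>Both functor laws equate arrows into a limit. Tested on the projections, they become the
  right unit law and associativity of the index category.\<close>

lemma dual_functor: "is_functor J C dual_functor"
proof -
  have "dual_map (Id J x) = Id C (L x)" if x: "x \<in> Obj J" for x
    using x
    by (intro p_cancel[OF x dual_map_Hom C.Id_Hom[OF L_closed[OF x]]])
      (auto simp: p_dual_map J.Comp_Id_Arr C.Comp_Id[OF p_Hom])
  moreover have "dual_map (g \<cdot>\<^bsub>J\<^esub> f) = dual_map g \<cdot>\<^bsub>C\<^esub> dual_map f"
    if [simp]: "f \<in> Arr J" "g \<in> Arr J" "Cod J f = Dom J g" for f g
  proof (rule p_cancel)
    note f = dual_map_Hom[of f, OF _ refl refl, simplified] and g = dual_map_Hom[of g, OF _ refl refl, simplified]
    show "dual_map (g \<cdot>\<^bsub>J\<^esub> f) \<in> Hom C (L (Dom J f)) (L (Cod J g))"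
      by (rule dual_map_Hom) (simp_all add: J.Comp_closed)
    show "dual_map g \<cdot>\<^bsub>C\<^esub> dual_map f \<in> Hom C (L (Dom J f)) (L (Cod J g))"
      by (rule C.Comp_Hom[OF f g])
    fix u assume u [simp]: "u \<in> Arr J" "Dom J u = Cod J g"
    show "p (Cod J g) u \<cdot>\<^bsub>C\<^esub> dual_map (g \<cdot>\<^bsub>J\<^esub> f) = p (Cod J g) u \<cdot>\<^bsub>C\<^esub> (dual_map g \<cdot>\<^bsub>C\<^esub> dual_map f)"
      using C.Comp_assoc[OF f g p_Hom[OF u refl]]
      by (simp add: p_dual_map J.Comp_closed J.Comp_assoc_Arr)
  qed (simp add: J.Cod_closed)
  ultimately show ?thesis
    by (auto simp: is_functor_def dual_functor_def L_closed J.Comp_closed Hom_def[of J] intro: dual_map_Hom)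
qed

section \<open>The evaluation as a natural transformation\<close>

definition ev_component :: "'i \<Rightarrow> 'a" where
  "ev_component x = C.ev (omap F x) \<cdot>\<^bsub>C\<^esub> (p x (Id J x) \<otimes>\<^sub>a\<^bsub>C\<^esub> Id C (omap F x))"

definition ev_trans :: "('i, 'j, 'o, 'a) nat_trans" where
  "ev_trans = NatTrans (dual_functor \<otimes>\<^bsub>FC\<^esub> F) \<one>\<^bsub>FC\<^esub> (\<lambda>x\<in>Obj J. ev_component x)"

lemma p_Id_Hom: "x \<in> Obj J \<Longrightarrow> p x (Id J x) \<in> Hom C (L x) (C.dual (omap F x))"
  by (rule p_Hom) simp_all

lemma ev_component_Comp:
  assumes x: "x \<in> Obj J" and v: "v \<in> Hom C T (L x)" and h: "h \<in> Hom C W (omap F x)"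
  shows "ev_component x \<cdot>\<^bsub>C\<^esub> (v \<otimes>\<^sub>a\<^bsub>C\<^esub> h) = C.ev (omap F x) \<cdot>\<^bsub>C\<^esub> ((p x (Id J x) \<cdot>\<^bsub>C\<^esub> v) \<otimes>\<^sub>a\<^bsub>C\<^esub> h)"
  unfolding ev_component_def
  by (rule C.ev_Comp_tensor[OF is_functorD(3)[OF F x] p_Id_Hom[OF x] v h, symmetric])

lemma ev_component_Hom:
  assumes x: "x \<in> Obj J"
  shows "ev_component x \<in> Hom C (L x \<otimes>\<^bsub>C\<^esub> omap F x) \<one>\<^bsub>C\<^esub>"
  unfolding ev_component_def
  using is_functorD(3)[OF F x] p_Id_Hom[OF x]
  by (blast intro: C.Comp_Hom C.TensA_Hom C.Id_Hom C.ev_Hom)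

text \<open>Naturality at f : x --> y rests on three facts. The identity projection at y after
  \<open>dual_map f\<close> is the f-projection at x; F f moves across the evaluation to its
  transpose; and the cone law at (Id, f) turns the transposed f-projection into the identity
  projection at x.\<close>

lemma ev_trans: "ev_trans \<in> Hom FC (dual_functor \<otimes>\<^bsub>FC\<^esub> F) \<one>\<^bsub>FC\<^esub>"
  unfolding ev_trans_def
proof (rule nat_transI[OF tensor_functor[OF dual_functor F] unit_functor])
  show "ev_component x \<in> Hom C (omap (dual_functor \<otimes>\<^bsub>FC\<^esub> F) x) (omap \<one>\<^bsub>FC\<^esub> x)" if "x \<in> Obj J" for x
    using that ev_component_Hom[OF that] by (simp add: functor_category_simps dual_functor_def)
  fix f assume f [simp]: "f \<in> Arr J"
  let ?x = "Dom J f" and ?y = "Cod J f"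
  have [simp]: "?x \<in> Obj J" "?y \<in> Obj J" by (auto simp: J.Dom_closed J.Cod_closed)
  note Ff = J.functor_amap_Hom[OF F f]
  have "ev_component ?y \<cdot>\<^bsub>C\<^esub> (dual_map f \<otimes>\<^sub>a\<^bsub>C\<^esub> amap F f) = C.ev (omap F ?y) \<cdot>\<^bsub>C\<^esub> (p ?x f \<otimes>\<^sub>a\<^bsub>C\<^esub> amap F f)"
    using ev_component_Comp[OF _ dual_map_Hom[OF f refl refl] Ff]
    by (simp add: p_dual_map J.Id_Comp_Arr)
  also have "\<dots> = C.ev (omap F ?x) \<cdot>\<^bsub>C\<^esub> ((C.dual_arr (amap F f) \<cdot>\<^bsub>C\<^esub> p ?x f) \<otimes>\<^sub>a\<^bsub>C\<^esub> Id C (omap F ?x))"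
    using C.ev_dual_arr[OF Ff p_Hom[OF f refl refl] C.Id_Hom[OF is_functorD(3)[OF F]]]
    by (simp add: C.Comp_Id[OF Ff])
  also have "C.dual_arr (amap F f) \<cdot>\<^bsub>C\<^esub> p ?x f = p ?x (Id J ?x)"
    using dual_arr_p[of "Id J ?x" f ?x] by (simp add: J.Comp_Id_Arr)
  also have "C.ev (omap F ?x) \<cdot>\<^bsub>C\<^esub> (p ?x (Id J ?x) \<otimes>\<^sub>a\<^bsub>C\<^esub> Id C (omap F ?x)) = Id C \<one>\<^bsub>C\<^esub> \<cdot>\<^bsub>C\<^esub> ev_component ?x"
    using C.Id_Comp[OF ev_component_Hom[of ?x]] by (simp add: ev_component_def)
  finally show "ev_component ?y \<cdot>\<^bsub>C\<^esub> amap (dual_functor \<otimes>\<^bsub>FC\<^esub> F) f = amap \<one>\<^bsub>FC\<^esub> f \<cdot>\<^bsub>C\<^esub> ev_component ?x"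
    by (simp add: functor_category_simps dual_functor_def)
qed

section \<open>Bijectivity of composition with the evaluation\<close>

lemma dual_functor_HomD:
  assumes h: "h \<in> Hom FC T dual_functor"
  shows "x \<in> Obj J \<Longrightarrow> component h x \<in> Hom C (omap T x) (L x)"
    and "f \<in> Arr J \<Longrightarrow> component h (Cod J f) \<cdot>\<^bsub>C\<^esub> amap T f = dual_map f \<cdot>\<^bsub>C\<^esub> component h (Dom J f)"
  using nat_transD(5,6)[OF h] by (auto simp: dual_functor_def)

text \<open>Naturality makes \<open>h\<close> determined by the projections of its components at identities.\<close>

lemma p_component:
  assumes h: "h \<in> Hom FC T dual_functor" and u [simp]: "u \<in> Arr J"
  shows "p (Dom J u) u \<cdot>\<^bsub>C\<^esub> component h (Dom J u) =
    (p (Cod J u) (Id J (Cod J u)) \<cdot>\<^bsub>C\<^esub> component h (Cod J u)) \<cdot>\<^bsub>C\<^esub> amap T u"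
proof -
  let ?x = "Dom J u" and ?y = "Cod J u"
  have [simp]: "?x \<in> Obj J" "?y \<in> Obj J" by (auto simp: J.Dom_closed J.Cod_closed)
  note H = dual_functor_HomD[OF h] and pI = p_Id_Hom[of ?y, simplified]
  have "p ?x u \<cdot>\<^bsub>C\<^esub> component h ?x = (p ?y (Id J ?y) \<cdot>\<^bsub>C\<^esub> dual_map u) \<cdot>\<^bsub>C\<^esub> component h ?x"
    by (simp add: p_dual_map J.Id_Comp_Arr)
  also have "\<dots> = p ?y (Id J ?y) \<cdot>\<^bsub>C\<^esub> (component h ?y \<cdot>\<^bsub>C\<^esub> amap T u)"
    using C.Comp_assoc[OF H(1)[of ?x] dual_map_Hom[OF u refl refl] pI] by (simp add: H(2))
  also have "\<dots> = (p ?y (Id J ?y) \<cdot>\<^bsub>C\<^esub> component h ?y) \<cdot>\<^bsub>C\<^esub> amap T u"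
    using C.Comp_assoc[OF J.functor_amap_Hom[OF nat_transD(1)[OF h] u] H(1)[of ?y] pI] by simp
  finally show ?thesis .
qed

text \<open>At each object the evaluated transformation is the uncurried identity projection of
  \<open>h\<close>, which makes the pre-dual bijection of \<open>C\<close> available
  pointwise.\<close>

lemma component_ev:
  assumes h: "h \<in> Hom FC T dual_functor" and x: "x \<in> Obj J"
  shows "component (ev_trans \<cdot>\<^bsub>FC\<^esub> (h \<otimes>\<^sub>a\<^bsub>FC\<^esub> Id FC F)) x =
    C.ev (omap F x) \<cdot>\<^bsub>C\<^esub> ((p x (Id J x) \<cdot>\<^bsub>C\<^esub> component h x) \<otimes>\<^sub>a\<^bsub>C\<^esub> Id C (omap F x))"
  using ev_component_Comp[OF x dual_functor_HomD(1)[OF h x] C.Id_Hom[OF is_functorD(3)[OF F x]]] x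
  by (simp add: functor_category_simps ev_trans_def)

text \<open>Equal evaluations give equal identity projections by \<open>ev_cancel\<close>;
  \<open>p_component\<close> extends this to all projections, and these are jointly monic.\<close>

lemma ev_trans_inj:
  assumes h: "h \<in> Hom FC T dual_functor" and k: "k \<in> Hom FC T dual_functor"
    and eq: "ev_trans \<cdot>\<^bsub>FC\<^esub> (h \<otimes>\<^sub>a\<^bsub>FC\<^esub> Id FC F) = ev_trans \<cdot>\<^bsub>FC\<^esub> (k \<otimes>\<^sub>a\<^bsub>FC\<^esub> Id FC F)"
  shows "h = k"
proof (rule nat_trans_eqI[OF h k])
  note H = dual_functor_HomD[OF h] and K = dual_functor_HomD[OF k] and T = nat_transD(1)[OF h]
  have id: "p x (Id J x) \<cdot>\<^bsub>C\<^esub> component h x = p x (Id J x) \<cdot>\<^bsub>C\<^esub> component k x" if x: "x \<in> Obj J" for x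
  proof (rule C.ev_cancel[OF is_functorD(3)[OF F x] is_functorD(3)[OF T x]
        C.Comp_Hom[OF H(1)[OF x] p_Id_Hom[OF x]] C.Comp_Hom[OF K(1)[OF x] p_Id_Hom[OF x]]])
    show "C.ev (omap F x) \<cdot>\<^bsub>C\<^esub> ((p x (Id J x) \<cdot>\<^bsub>C\<^esub> component h x) \<otimes>\<^sub>a\<^bsub>C\<^esub> Id C (omap F x)) =
        C.ev (omap F x) \<cdot>\<^bsub>C\<^esub> ((p x (Id J x) \<cdot>\<^bsub>C\<^esub> component k x) \<otimes>\<^sub>a\<^bsub>C\<^esub> Id C (omap F x))"
      unfolding component_ev[OF h x, symmetric] component_ev[OF k x, symmetric] eq ..
  qed
  show "component h x = component k x" if x: "x \<in> Obj J" for x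
  proof (rule p_cancel[OF x H(1)[OF x] K(1)[OF x]])
    fix u assume u: "u \<in> Arr J" "Dom J u = x"
    show "p x u \<cdot>\<^bsub>C\<^esub> component h x = p x u \<cdot>\<^bsub>C\<^esub> component k x"
      using p_component[OF h u(1)] p_component[OF k u(1)] id[OF J.Cod_closed[OF u(1)]] u(2) by simp
  qed
qed

text \<open>The components of \<open>t\<close> are curried in \<open>C\<close> and spread over all
  arrows u by precomposing with T u; the limits assemble the result into \<open>h\<close>.\<close>

lemma ev_trans_surj:
  assumes T: "is_functor J C T" and t: "t \<in> Hom FC (T \<otimes>\<^bsub>FC\<^esub> F) \<one>\<^bsub>FC\<^esub>"
  shows "\<exists>h \<in> Hom FC T dual_functor. ev_trans \<cdot>\<^bsub>FC\<^esub> (h \<otimes>\<^sub>a\<^bsub>FC\<^esub> Id FC F) = t"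
proof -
  note TO = is_functorD(3)[OF T] and FO = is_functorD(3)[OF F]
  note Tf = J.functor_amap_Hom[OF T] and Ff = J.functor_amap_Hom[OF F]
  note [simp] = J.Dom_closed J.Cod_closed J.Comp_closed
  have t_Hom: "component t x \<in> Hom C (omap T x \<otimes>\<^bsub>C\<^esub> omap F x) \<one>\<^bsub>C\<^esub>" if "x \<in> Obj J" for x
    using nat_transD(5)[OF t that] that by (simp add: functor_category_simps)
  \<comment> \<open>The unit functor sends \<open>f\<close> to an identity, which disappears from
    the naturality square.\<close>
  have t_nat: "component t (Cod J f) \<cdot>\<^bsub>C\<^esub> (amap T f \<otimes>\<^sub>a\<^bsub>C\<^esub> amap F f) = component t (Dom J f)"
    if "f \<in> Arr J" for f
    using nat_transD(6)[OF t that] that C.Id_Comp[OF t_Hom[of "Dom J f"]]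
    by (simp add: functor_category_simps)
  have "\<exists>u. u \<in> Hom C (omap T x) (C.dual (omap F x)) \<and>
      C.ev (omap F x) \<cdot>\<^bsub>C\<^esub> (u \<otimes>\<^sub>a\<^bsub>C\<^esub> Id C (omap F x)) = component t x" if "x \<in> Obj J" for x
    using C.curry_exists[OF FO TO t_Hom] that by blast
  then obtain s where s: "\<And>x. x \<in> Obj J \<Longrightarrow> s x \<in> Hom C (omap T x) (C.dual (omap F x))"
    and ev_s: "\<And>x. x \<in> Obj J \<Longrightarrow>
      C.ev (omap F x) \<cdot>\<^bsub>C\<^esub> (s x \<otimes>\<^sub>a\<^bsub>C\<^esub> Id C (omap F x)) = component t x"
    by metis
  have q: "s (Cod J f) \<cdot>\<^bsub>C\<^esub> amap T f \<in> Hom C (omap T (Dom J f)) (C.dual (omap F (Cod J f)))"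
    if "f \<in> Arr J" for f
    using that by (intro C.Comp_Hom[OF Tf s]) auto
  \<comment> \<open>After evaluation, F f moves to the other factor, and the left side becomes the
    component of \<open>t\<close> at the codomain composed with T f tensor F f. Naturality of
    \<open>t\<close> then gives its component at the domain.\<close>
  have dual_arr_s: "C.dual_arr (amap F f) \<cdot>\<^bsub>C\<^esub> (s (Cod J f) \<cdot>\<^bsub>C\<^esub> amap T f) = s (Dom J f)"
    if f: "f \<in> Arr J" for f
  proof (rule C.ev_cancel)
    let ?x = "Dom J f" and ?y = "Cod J f"
    have "C.ev (omap F ?x) \<cdot>\<^bsub>C\<^esub> ((C.dual_arr (amap F f) \<cdot>\<^bsub>C\<^esub> (s ?y \<cdot>\<^bsub>C\<^esub> amap T f)) \<otimes>\<^sub>a\<^bsub>C\<^esub> Id C (omap F ?x))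
      = C.ev (omap F ?y) \<cdot>\<^bsub>C\<^esub> ((s ?y \<cdot>\<^bsub>C\<^esub> amap T f) \<otimes>\<^sub>a\<^bsub>C\<^esub> amap F f)"
      using C.ev_dual_arr[OF Ff[OF f] q[OF f] C.Id_Hom[OF FO]] f by (simp add: C.Comp_Id[OF Ff])
    also have "\<dots> = component t ?x"
      using C.ev_Comp_tensor[OF FO s Tf[OF f] Ff[OF f]] f by (simp add: ev_s t_nat)
    finally show "C.ev (omap F ?x) \<cdot>\<^bsub>C\<^esub>
        ((C.dual_arr (amap F f) \<cdot>\<^bsub>C\<^esub> (s ?y \<cdot>\<^bsub>C\<^esub> amap T f)) \<otimes>\<^sub>a\<^bsub>C\<^esub> Id C (omap F ?x))
      = C.ev (omap F ?x) \<cdot>\<^bsub>C\<^esub> (s ?x \<otimes>\<^sub>a\<^bsub>C\<^esub> Id C (omap F ?x))"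
      using f by (simp add: ev_s)
  qed (use f in \<open>auto intro: FO TO s C.Comp_Hom[OF q C.dual_arr_Hom[OF Ff]]\<close>)
  \<comment> \<open>The cone law at (u, f) is \<open>dual_arr_s\<close> for \<open>f\<close>,
    precomposed with T u.\<close>
  have "\<exists>h. h \<in> Hom C (omap T x) (L x) \<and>
      (\<forall>u \<in> Arr J. Dom J u = x \<longrightarrow> p x u \<cdot>\<^bsub>C\<^esub> h = s (Cod J u) \<cdot>\<^bsub>C\<^esub> amap T u)" if x: "x \<in> Obj J" for x
  proof (rule ex1_implies_ex, rule p_universal[OF x TO[OF x]])
    fix u f assume u: "u \<in> Arr J" "f \<in> Arr J" "Dom J u = x" "Dom J f = Cod J u"
    have "C.dual_arr (amap F f) \<cdot>\<^bsub>C\<^esub> (s (Cod J f) \<cdot>\<^bsub>C\<^esub> (amap T f \<cdot>\<^bsub>C\<^esub> amap T u)) =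
        (C.dual_arr (amap F f) \<cdot>\<^bsub>C\<^esub> (s (Cod J f) \<cdot>\<^bsub>C\<^esub> amap T f)) \<cdot>\<^bsub>C\<^esub> amap T u"
      using C.Comp_assoc[OF _ Tf[of f] s, of "amap T u"]
        C.Comp_assoc[OF _ q[of f] C.dual_arr_Hom[OF Ff[of f]], of "amap T u"] Tf[of u] u by simp
    then show "C.dual_arr (amap F f) \<cdot>\<^bsub>C\<^esub> (s (Cod J (f \<cdot>\<^bsub>J\<^esub> u)) \<cdot>\<^bsub>C\<^esub> amap T (f \<cdot>\<^bsub>J\<^esub> u)) =
        s (Cod J u) \<cdot>\<^bsub>C\<^esub> amap T u"
      using u dual_arr_s[of f] is_functorD(5)[OF T, of u f] by simp
  qed (use q in auto)
  then obtain h where h: "\<And>x. x \<in> Obj J \<Longrightarrow> h x \<in> Hom C (omap T x) (L x)"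
    and p_h: "\<And>x u. \<lbrakk>x \<in> Obj J; u \<in> Arr J; Dom J u = x\<rbrakk> \<Longrightarrow> p x u \<cdot>\<^bsub>C\<^esub> h x = s (Cod J u) \<cdot>\<^bsub>C\<^esub> amap T u"
    by metis
  have H: "NatTrans T dual_functor (\<lambda>x\<in>Obj J. h x) \<in> Hom FC T dual_functor" (is "?h \<in> _")
  proof (rule nat_transI[OF T dual_functor])
    show "h x \<in> Hom C (omap T x) (omap dual_functor x)" if "x \<in> Obj J" for x
      using h that by (simp add: dual_functor_def)
    fix f assume f: "f \<in> Arr J"
    note hx = h[of "Dom J f"] and hy = h[of "Cod J f"] and df = dual_map_Hom[OF f refl refl]
    have "h (Cod J f) \<cdot>\<^bsub>C\<^esub> amap T f = dual_map f \<cdot>\<^bsub>C\<^esub> h (Dom J f)"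
    \<comment> \<open>Both sides have the same u-component, \<open>s (Cod J u)\<close> composed with
      T (u f): on the left through functoriality of T, on the right because
      \<open>dual_map f\<close> reindexes u to u f.\<close>
    proof (rule p_cancel)
      show "h (Cod J f) \<cdot>\<^bsub>C\<^esub> amap T f \<in> Hom C (omap T (Dom J f)) (L (Cod J f))"
        using f by (intro C.Comp_Hom[OF Tf hy]) auto
      show "dual_map f \<cdot>\<^bsub>C\<^esub> h (Dom J f) \<in> Hom C (omap T (Dom J f)) (L (Cod J f))"
        using f by (intro C.Comp_Hom[OF hx df]) auto
      fix u assume u: "u \<in> Arr J" "Dom J u = Cod J f"
      have "p (Cod J f) u \<cdot>\<^bsub>C\<^esub> (h (Cod J f) \<cdot>\<^bsub>C\<^esub> amap T f) = (s (Cod J u) \<cdot>\<^bsub>C\<^esub> amap T u) \<cdot>\<^bsub>C\<^esub> amap T f"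
        using C.Comp_assoc[OF Tf[OF f] hy p_Hom[OF u refl]] f u by (simp add: p_h)
      also have "\<dots> = s (Cod J u) \<cdot>\<^bsub>C\<^esub> (amap T u \<cdot>\<^bsub>C\<^esub> amap T f)"
        using C.Comp_assoc[OF Tf[OF f] _ s, of "amap T u"] Tf[of u] u by simp
      also have "\<dots> = p (Dom J f) (u \<cdot>\<^bsub>J\<^esub> f) \<cdot>\<^bsub>C\<^esub> h (Dom J f)"
        using f u is_functorD(5)[OF T, of f u] by (simp add: p_h)
      also have "\<dots> = p (Cod J f) u \<cdot>\<^bsub>C\<^esub> (dual_map f \<cdot>\<^bsub>C\<^esub> h (Dom J f))"
        using C.Comp_assoc[OF hx df p_Hom[OF u refl]] f u by (simp add: p_dual_map)
      finally show "p (Cod J f) u \<cdot>\<^bsub>C\<^esub> (h (Cod J f) \<cdot>\<^bsub>C\<^esub> amap T f) =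
        p (Cod J f) u \<cdot>\<^bsub>C\<^esub> (dual_map f \<cdot>\<^bsub>C\<^esub> h (Dom J f))" .
    qed (use f in simp)
    then show "h (Cod J f) \<cdot>\<^bsub>C\<^esub> amap T f = amap dual_functor f \<cdot>\<^bsub>C\<^esub> h (Dom J f)"
      using f by (simp add: dual_functor_def)
  qed
  \<comment> \<open>At the identity, T u is an identity and the projection of \<open>h x\<close> is
    \<open>s x\<close> itself. By \<open>component_ev\<close> this projection alone determines the
    evaluation.\<close>
  have "p x (Id J x) \<cdot>\<^bsub>C\<^esub> h x = s x" if "x \<in> Obj J" for x
    using that by (simp add: p_h is_functorD(4)[OF T] C.Comp_Id[OF s])
  then have "ev_trans \<cdot>\<^bsub>FC\<^esub> (?h \<otimes>\<^sub>a\<^bsub>FC\<^esub> Id FC F) = t"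
    by (intro nat_trans_eqI[OF Comp_nat_trans[OF TensA_nat_trans[OF H Id_nat_trans[OF F]] ev_trans] t])
      (simp add: component_ev[OF H] ev_s)
  then show ?thesis using H by blast
qed

lemma is_pre_dual_dual_functor: "is_pre_dual FC F dual_functor ev_trans"
proof -
  have "bij_betw (\<lambda>h. ev_trans \<cdot>\<^bsub>FC\<^esub> (h \<otimes>\<^sub>a\<^bsub>FC\<^esub> Id FC F))
      (Hom FC T dual_functor) (Hom FC (T \<otimes>\<^bsub>FC\<^esub> F) \<one>\<^bsub>FC\<^esub>)" if T: "is_functor J C T" for T
  proof (rule bij_betw_imageI)
    show "inj_on (\<lambda>h. ev_trans \<cdot>\<^bsub>FC\<^esub> (h \<otimes>\<^sub>a\<^bsub>FC\<^esub> Id FC F)) (Hom FC T dual_functor)"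
      by (auto intro!: inj_onI ev_trans_inj)
    show "(\<lambda>h. ev_trans \<cdot>\<^bsub>FC\<^esub> (h \<otimes>\<^sub>a\<^bsub>FC\<^esub> Id FC F)) ` Hom FC T dual_functor =
        Hom FC (T \<otimes>\<^bsub>FC\<^esub> F) \<one>\<^bsub>FC\<^esub>"
    proof (intro set_eqI iffI)
      fix t assume "t \<in> Hom FC (T \<otimes>\<^bsub>FC\<^esub> F) \<one>\<^bsub>FC\<^esub>"
      from ev_trans_surj[OF T this]
      show "t \<in> (\<lambda>h. ev_trans \<cdot>\<^bsub>FC\<^esub> (h \<otimes>\<^sub>a\<^bsub>FC\<^esub> Id FC F)) ` Hom FC T dual_functor" by blast
    qed (use Comp_nat_trans[OF TensA_nat_trans[OF _ Id_nat_trans[OF F]] ev_trans] in blast)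
  qed
  then show ?thesis
    using dual_functor ev_trans by (simp add: is_pre_dual_def functor_category_simps(1))
qed

end

end

theorem proposition3p11:
  fixes \<kappa> :: "'u rel"
    and \<I> :: "('i, 'j) category"
    and \<C> :: "('o, 'a) monoidal_category"
  assumes "Card_order \<kappa>" and "cinfinite \<kappa>"
    and "small_category \<I> \<kappa>"
    and "monoidal_category \<C>" and "complete \<kappa> \<C>"
    and "pre_rigid_category \<C>"
  shows "pre_rigid_category (functor_category \<I> \<C>)"
proof -
  interpret small_category \<I> \<kappa> by (rule assms(3))
  interpret C: pre_rigid_category \<C> by (rule assms(6))
  interpret pre_rigid_index \<I> \<C> by unfold_locales
  interpret FC: monoidal_category FC by (rule monoidal_FC)
  show ?thesis
  proof unfold_locales
    fix F assume "F \<in> Obj FC"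
    then have F: "is_functor \<I> \<C> F" by (simp add: functor_category_simps)
    \<comment> \<open>Here \<open>x\<close> ranges over the whole type, so that \<open>L\<close> and
      \<open>p\<close> can be chosen without a side condition. If \<open>x\<close> is not an object,
      the coslice is empty and the limit is a terminal object.\<close>
    have "\<exists>L p. is_limit (coslice_op \<I> x) \<C> (dual_diagram F x) L p" for x
      by (rule complete_imp_limit[OF assms(5,1) small_coslice_op[OF assms(1,2)] dual_diagram_functor[OF F]])
    then obtain L p where "\<And>x. is_limit (coslice_op \<I> x) \<C> (dual_diagram F x) (L x) (p x)"
      by metis
    from is_pre_dual_dual_functor[OF F this]
    show "\<exists>X' e. is_pre_dual FC F X' e" by blast
  qed
qed

end
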